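(* Let $n\geq 6$. Among all connected cubic bipartite graphs on $2n$ vertices, $H_{2n}$ is the unique graph (up to isomorphism) with the minimum algebraic connectivity.
   Context: All graphs are finite, simple and undirected. A graph is cubic if every vertex has degree $3$. For a graph $G$ with adjacency matrix $A(G)$ and diagonal matrix of vertex degrees $D(G)$, the Laplacian matrix is $L(G)=D(G)-A(G)$. The algebraic connectivity $a(G)$ is the second smallest eigenvalue of $L(G)$ (counted with multiplicity). For $n\ge 6$, $H_{2n}$ is the cubic bipartite graph with parts $\{u_1,\dots,u_n\}$ and $\{v_1,\dots,v_n\}$ and exactly the following edges: (i) $u_iv_j$ for all $i,j\in\{1,2,3\}$ except $(i,j)=(3,3)$; (ii) $u_iv_{i+1}$ and $v_iu_{i+1}$ for $3\le i\le n-3$; (iii) $u_iv_i$ for $4\le i\le n-3$; (iv) $u_iv_j$ for all $i,j\in\{n-2,n-1,n\}$ except $(i,j)=(n-2,n-2)$. *)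

theory Defs
  imports
    "Graph_Theory.Pair_Digraph"
    "Graph_Theory.Digraph_Isomorphism"
    "Jordan_Normal_Form.Char_Poly"
begin

text \<open>
  A finite simple undirected graph is a \<^locale>\<open>pair_graph\<close>: finitely many vertices, no loops, and
  a symmetric set of arcs, each edge being represented by its two orientations.  Hence the degree
  of a vertex is its out-degree.
\<close>

definition cubic :: "'a pair_pre_digraph \<Rightarrow> bool" where
  "cubic G \<longleftrightarrow> (\<forall>v \<in> pverts G. out_degree (with_proj G) v = 3)"

definition bipartite :: "'a pair_pre_digraph \<Rightarrow> bool" where
  "bipartite G \<longleftrightarrow> (\<exists>X Y. X \<union> Y = pverts G \<and> X \<inter> Y = {} \<and> parcs G \<subseteq> X \<times> Y \<union> Y \<times> X)"

definition connected_cubic_bipartite :: "nat \<Rightarrow> 'a pair_pre_digraph \<Rightarrow> bool" where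
  "connected_cubic_bipartite N G \<longleftrightarrow>
     pair_graph G \<and> Digraph_Component.connected (with_proj G) \<and> cubic G \<and> bipartite G \<and>
     card (pverts G) = N"

text \<open>Matrices are indexed by the positions of an enumeration \<open>vs\<close> of the vertices.\<close>

definition adjacency_mat :: "'a pair_pre_digraph \<Rightarrow> 'a list \<Rightarrow> real mat" where
  "adjacency_mat G vs =
     mat (length vs) (length vs) (\<lambda>(i, j). if (vs ! i, vs ! j) \<in> parcs G then 1 else 0)"

definition degree_mat :: "'a pair_pre_digraph \<Rightarrow> 'a list \<Rightarrow> real mat" where
  "degree_mat G vs =
     mat (length vs) (length vs)
       (\<lambda>(i, j). if i = j then real (out_degree (with_proj G) (vs ! i)) else 0)"

definition laplacian_mat :: "'a pair_pre_digraph \<Rightarrow> 'a list \<Rightarrow> real mat" where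
  "laplacian_mat G vs = degree_mat G vs - adjacency_mat G vs"

text \<open>
  The eigenvalues of the Laplacian with algebraic multiplicity.  The choice of the enumeration is
  immaterial (\<open>laplacian_spectrum_eq\<close> below), and since the Laplacian is real symmetric, no
  eigenvalue is lost by taking only the real roots (\<open>size_laplacian_spectrum\<close> below).
\<close>

definition laplacian_spectrum :: "'a pair_pre_digraph \<Rightarrow> real multiset" where
  "laplacian_spectrum G =
     proots (char_poly (laplacian_mat G (SOME vs. distinct vs \<and> set vs = pverts G)))"

definition algebraic_connectivity :: "'a pair_pre_digraph \<Rightarrow> real" where
  "algebraic_connectivity G = sorted_list_of_multiset (laplacian_spectrum G) ! 1"

text \<open>
  The graph \<open>H\<^sub>2\<^sub>n\<close>, with argument \<open>n\<close>: \<open>Inl i\<close> is the vertex \<open>u\<^sub>i\<close> and \<open>Inr j\<close> the vertex \<open>v\<^sub>j\<close>, and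
  \<open>H_edge n i j\<close> says that \<open>u\<^sub>i v\<^sub>j\<close> is an edge.  It is meant for \<open>n \<ge> 6\<close> only.
\<close>

definition H_edge :: "nat \<Rightarrow> nat \<Rightarrow> nat \<Rightarrow> bool" where
  "H_edge n i j \<longleftrightarrow>
     (i \<in> {1, 2, 3} \<and> j \<in> {1, 2, 3} \<and> (i, j) \<noteq> (3, 3)) \<or>
     (3 \<le> i \<and> i \<le> n - 3 \<and> j = i + 1) \<or>
     (3 \<le> j \<and> j \<le> n - 3 \<and> i = j + 1) \<or>
     (4 \<le> i \<and> i \<le> n - 3 \<and> j = i) \<or>
     (i \<in> {n - 2, n - 1, n} \<and> j \<in> {n - 2, n - 1, n} \<and> (i, j) \<noteq> (n - 2, n - 2))"

definition H_graph :: "nat \<Rightarrow> (nat + nat) pair_pre_digraph" where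
  "H_graph n =
     \<lparr> pverts = Inl ` {1..n} \<union> Inr ` {1..n},
       parcs = {(Inl i, Inr j) | i j. H_edge n i j} \<union> {(Inr j, Inl i) | i j. H_edge n i j} \<rparr>"

lemma laplacian_mat_carrier [simp]:
  "laplacian_mat G vs \<in> carrier_mat (length vs) (length vs)"
  by (rule carrier_matI) (simp_all add: laplacian_mat_def degree_mat_def adjacency_mat_def)

lemma laplacian_mat_index:
  assumes "i < length vs" "j < length vs"
  shows "laplacian_mat G vs $$ (i, j) =
    (if i = j then real (out_degree (with_proj G) (vs ! i)) else 0)
    - (if (vs ! i, vs ! j) \<in> parcs G then 1 else 0)"
  using assms by (simp add: laplacian_mat_def degree_mat_def adjacency_mat_def)

lemma similar_laplacian_mat:
  assumes vs: "distinct vs" "set vs = pverts G" and ws: "distinct ws" "set ws = pverts G"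
  shows "similar_mat (laplacian_mat G vs) (laplacian_mat G ws)"
proof -
  define m where "m = card (pverts G)"
  have m: "length vs = m" "length ws = m"
    using distinct_card[OF vs(1)] distinct_card[OF ws(1)] vs(2) ws(2) by (simp_all add: m_def)
  have b1: "bij_betw ((!) ws) {..<m} (pverts G)"
    using bij_betw_nth[OF ws(1)] m(2) ws(2) by simp
  have b2: "bij_betw ((!) vs) {..<m} (pverts G)"
    using bij_betw_nth[OF vs(1)] m(1) vs(2) by simp
  define p where "p = the_inv_into {..<m} ((!) ws) \<circ> (!) vs"
  have p: "bij_betw p {..<m} {..<m}"
    unfolding p_def by (rule bij_betw_trans[OF b2 bij_betw_the_inv_into[OF b1]])
  have vp: "vs ! i = ws ! p i" if "i < m" for i
  proof -
    have "vs ! i \<in> pverts G" using that m(1) vs(2) nth_mem by metis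
    then show ?thesis unfolding p_def by (simp add: f_the_inv_into_f_bij_betw[OF b1])
  qed
  have pm: "p i < m" if "i < m" for i
    using bij_betwE[OF p] that by simp
  have pinj: "p i = p j \<longleftrightarrow> i = j" if "i < m" "j < m" for i j
    using bij_betw_imp_inj_on[OF p] that by (simp add: inj_on_eq_iff)
  define P :: "real mat" where "P = mat m m (\<lambda>(i, j). if j = p i then 1 else 0)"
  have P: "P \<in> carrier_mat m m" by (simp add: P_def)
  then have PT: "P\<^sup>T \<in> carrier_mat m m" by simp
  define V W where "V = laplacian_mat G vs" and "W = laplacian_mat G ws"
  have V: "V \<in> carrier_mat m m" and W: "W \<in> carrier_mat m m"
    using laplacian_mat_carrier[of G vs] laplacian_mat_carrier[of G ws] m
    by (simp_all add: V_def W_def)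
  have row: "(P * B) $$ (i, j) = B $$ (p i, j)"
    if "B \<in> carrier_mat m m" "i < m" "j < m" for B i j
  proof -
    have "(P * B) $$ (i, j) = (\<Sum>k\<in>{0..<m}. (if k = p i then 1 else 0) * B $$ (k, j))"
      using that by (simp add: P_def scalar_prod_def)
    also have "\<dots> = (\<Sum>k\<in>{0..<m}. if k = p i then B $$ (k, j) else 0)"
      by (intro sum.cong) auto
    also have "\<dots> = B $$ (p i, j)" using pm[OF that(2)] by simp
    finally show ?thesis .
  qed
  have col: "(B * P\<^sup>T) $$ (i, j) = B $$ (i, p j)"
    if "B \<in> carrier_mat m m" "i < m" "j < m" for B i j
  proof -
    have "(B * P\<^sup>T) $$ (i, j) = (\<Sum>k\<in>{0..<m}. B $$ (i, k) * (if k = p j then 1 else 0))"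
      using that by (simp add: P_def scalar_prod_def)
    also have "\<dots> = (\<Sum>k\<in>{0..<m}. if k = p j then B $$ (i, k) else 0)"
      by (intro sum.cong) auto
    also have "\<dots> = B $$ (i, p j)" using pm[OF that(3)] by simp
    finally show ?thesis .
  qed
  have PPT: "P * P\<^sup>T = 1\<^sub>m m"
  proof (rule eq_matI)
    fix i j assume "i < dim_row (1\<^sub>m m)" "j < dim_col (1\<^sub>m m :: real mat)"
    then have ij: "i < m" "j < m" by simp_all
    show "(P * P\<^sup>T) $$ (i, j) = 1\<^sub>m m $$ (i, j)"
      unfolding col[OF P ij] using ij pm pinj by (simp add: P_def)
  qed (simp_all add: P_def)
  have PTP: "P\<^sup>T * P = 1\<^sub>m m"
    by (rule mat_mult_left_right_inverse[OF P PT PPT])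
  have "V = P * W * P\<^sup>T"
  proof (rule eq_matI)
    fix i j assume "i < dim_row (P * W * P\<^sup>T)" and "j < dim_col (P * W * P\<^sup>T)"
    then have ij: "i < m" "j < m" by (simp_all add: P_def)
    have "(P * W * P\<^sup>T) $$ (i, j) = W $$ (p i, p j)"
      using col[OF mult_carrier_mat[OF P W] ij] row[OF W ij(1) pm[OF ij(2)]] by simp
    also have "\<dots> = V $$ (i, j)"
      unfolding V_def W_def using ij m pm vp pinj by (simp add: laplacian_mat_index)
    finally show "V $$ (i, j) = (P * W * P\<^sup>T) $$ (i, j)" ..
  qed (use V P in simp_all)
  then show ?thesis
    unfolding V_def[symmetric] W_def[symmetric]
    by (intro similar_matI[OF _ PPT PTP]) (use V W P PT in simp_all)
qed

lemma laplacian_spectrum_eq: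
  assumes "distinct vs" "set vs = pverts G"
  shows "laplacian_spectrum G = proots (char_poly (laplacian_mat G vs))"
proof -
  let ?ws = "SOME vs. distinct vs \<and> set vs = pverts G"
  have "distinct ?ws \<and> set ?ws = pverts G"
    by (rule someI[of "\<lambda>vs. distinct vs \<and> set vs = pverts G" vs]) (use assms in simp)
  then show ?thesis
    unfolding laplacian_spectrum_def
    using char_poly_similar[OF similar_laplacian_mat[of ?ws G vs]] assms by simp
qed

lemma size_proots_char_poly_symmetric:
  fixes A :: "real mat"
  assumes A: "A \<in> carrier_mat m m" and sym: "\<And>i j. i < m \<Longrightarrow> j < m \<Longrightarrow> A $$ (i, j) = A $$ (j, i)"
  shows "size (proots (char_poly A)) = m"
proof -
  interpret of_real_poly_hom: map_poly_inj_idom_hom "of_real :: real \<Rightarrow> complex" ..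
  define C :: "complex mat" where "C = map_mat of_real A"
  have C: "C \<in> carrier_mat m m" using A by (simp add: C_def)
  have real: "a \<in> \<real>" if "poly (char_poly C) a = 0" for a
  proof -
    from that obtain v where v: "v \<in> carrier_vec m" "v \<noteq> 0\<^sub>v m" "C *\<^sub>v v = a \<cdot>\<^sub>v v"
      using eigenvalue_root_char_poly[OF C, of a] C by (auto simp: eigenvalue_def eigenvector_def)
    define S where "S = (\<Sum>i<m. \<Sum>j<m. cnj (v $ i) * C $$ (i, j) * v $ j)"
    define N where "N = (\<Sum>i<m. (cmod (v $ i))\<^sup>2)"
    have Cv: "(\<Sum>j<m. C $$ (i, j) * v $ j) = a * v $ i" if "i < m" for i
    proof -
      have "(C *\<^sub>v v) $ i = (\<Sum>j<m. C $$ (i, j) * v $ j)"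
        using that C v(1) by (simp add: scalar_prod_def lessThan_atLeast0)
      then show ?thesis using v that by simp
    qed
    have "S = (\<Sum>i<m. cnj (v $ i) * (a * v $ i))"
      unfolding S_def using Cv by (intro sum.cong) (simp_all add: sum_distrib_left mult.assoc flip: Cv)
    also have "\<dots> = a * of_real N"
      unfolding N_def of_real_sum sum_distrib_left
      by (intro sum.cong) (simp_all add: complex_norm_square algebra_simps flip: of_real_power)
    finally have S: "S = a * of_real N" .
    have "cnj S = (\<Sum>i<m. \<Sum>j<m. cnj (v $ j) * C $$ (j, i) * v $ i)"
      unfolding S_def cnj_sum
      by (intro sum.cong) (use A sym in \<open>auto simp: C_def algebra_simps\<close>)
    also have "\<dots> = S" unfolding S_def by (rule sum.swap)
    finally have "cnj a * of_real N = a * of_real N" using S by simp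
    moreover have "N \<noteq> 0"
    proof
      assume "N = 0"
      then have "\<forall>i<m. v $ i = 0"
        unfolding N_def by (subst (asm) sum_nonneg_eq_0_iff) auto
      then show False using v by (auto intro: eq_vecI)
    qed
    ultimately show ?thesis by (simp add: Reals_cnj_iff)
  qed
  obtain as where as: "char_poly C = (\<Prod>a\<leftarrow>as. [:- a, 1:])" and len: "length as = m"
    using char_poly_factorized[OF C] by blast
  have "of_real (Re a) = a" if "a \<in> set as" for a
  proof -
    have "poly (char_poly C) a = 0"
      using that unfolding as poly_prod_list by (auto simp: prod_list_zero_iff image_iff)
    then show ?thesis using real by simp
  qed
  then have "char_poly C = (\<Prod>a\<leftarrow>map Re as. [:- of_real a, 1:])"
    unfolding as by (simp add: o_def cong: map_cong)
  also have "\<dots> = map_poly of_real (\<Prod>r\<leftarrow>map Re as. [:- r, 1:])"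
    by (induction as) (simp_all add: of_real_poly_hom.hom_mult del: mult_pCons_left)
  finally have "map_poly complex_of_real (char_poly A) = map_poly of_real (\<Prod>r\<leftarrow>map Re as. [:- r, 1:])"
    unfolding C_def of_real_hom.char_poly_hom[OF A] .
  then have "char_poly A = (\<Prod>r\<leftarrow>map Re as. [:- r, 1:])"
    by (simp only: of_real_poly_hom.eq_iff)
  moreover have "size (proots (\<Prod>r\<leftarrow>rs. [:- r, 1:])) = length rs" for rs :: "real list"
  proof (induction rs)
    case (Cons r rs)
    have "(\<Prod>r\<leftarrow>rs. [:- r, 1:]) \<noteq> 0" by (induction rs) (auto simp del: mult_pCons_left)
    with proots_mult[of "[:- r, 1:]" "\<Prod>r\<leftarrow>rs. [:- r, 1:]"] Cons show ?case
      by (simp del: mult_pCons_left)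
  qed simp
  ultimately show ?thesis using len by (simp del: map_map)
qed

lemma size_laplacian_spectrum:
  assumes "pair_graph G"
  shows "size (laplacian_spectrum G) = card (pverts G)"
proof -
  interpret pair_graph G by fact
  obtain vs where vs: "distinct vs" "set vs = pverts G"
    using finite_distinct_list[OF pair_finite_verts] by blast
  have symm: "(u, v) \<in> parcs G \<longleftrightarrow> (v, u) \<in> parcs G" for u v
    using arcs_ends_symmetric[OF pair_sym_arcs] by auto
  have "size (proots (char_poly (laplacian_mat G vs))) = length vs"
    by (rule size_proots_char_poly_symmetric) (auto simp: laplacian_mat_index symm)
  then show ?thesis using vs distinct_card[of vs] by (simp add: laplacian_spectrum_eq)
qed
end

theory Submission
  imports Defs "Jordan_Normal_Form.Schur_Decomposition" "HOL-Analysis.Function_Topology"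
begin

text \<open>
  Let \<open>f\<close> be a real function on the vertices of a connected cubic bipartite graph \<open>G\<close> on \<open>2n\<close> vertices,
  with mean \<open>0\<close> and with Rayleigh quotient at most the algebraic connectivity of \<open>G\<close>.  Sort the values
  of \<open>f\<close> on each of the two colour classes: \<open>u\<^sub>1 \<ge> \<dots> \<ge> u\<^sub>n\<close> and \<open>v\<^sub>1 \<ge> \<dots> \<ge> v\<^sub>n\<close>.  Since \<open>G\<close> is cubic,
  its Dirichlet form at \<open>f\<close> is \<open>3 \<Sum> f\<^sup>2 - 2 \<Sum> u\<^sub>i v\<^sub>j\<close>, the last sum being over the edges.  Summation by parts
  in both indices writes the edge sum, up to terms that are the same for all cubic graphs, as a
  combination, with the nonnegative coefficients \<open>(u\<^sub>i - u\<^sub>i\<^sub>+\<^sub>1) (v\<^sub>j - v\<^sub>j\<^sub>+\<^sub>1)\<close>, of the \<^emph>\<open>corner counts\<close>: the numbers of edges between the first \<open>i\<close>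
  vertices of one class and the first \<open>j\<close> vertices of the other.

  The point is that \<open>H\<^sub>2\<^sub>n\<close> maximises all corner counts at once
  (\<open>corner_le_corner_H\<close>).  Four bounds hold for every cubic bipartite graph: \<open>3i\<close>, \<open>3j\<close>, \<open>ij\<close>,
  and the analogue of \<open>ij\<close> for the complementary corner.  Connectedness improves \<open>3i\<close> to
  \<open>3i - 1\<close> on the diagonal, as otherwise the first \<open>i\<close> vertices of both classes would be cut off.  For
  every \<open>(i, j)\<close> with \<open>i, j < n\<close> one of these bounds is attained by \<open>H\<^sub>2\<^sub>n\<close>.  Hence moving the sorted
  values of \<open>f\<close> to \<open>H\<^sub>2\<^sub>n\<close> does not increase the Rayleigh quotient, and the variational characterisation of
  the algebraic connectivity gives the inequality.

  If equality holds, the moved function is an eigenfunction of \<open>H\<^sub>2\<^sub>n\<close> for its second eigenvalue, and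
  the corner counts of \<open>G\<close> and \<open>H\<^sub>2\<^sub>n\<close> agree wherever both sequences drop strictly.  The eigenvalue equation
  forces strict drops at all indices from \<open>2\<close> to \<open>n - 2\<close> (\<open>H_eigenpair.u_strict\<close>).  Other ties can
  only concern the twin vertices at both ends, and the biadjacency matrix of \<open>H\<^sub>2\<^sub>n\<close> is constant on the blocks
  cut out by the strict drops, so these counts determine the graph
  (\<open>cubic_matrix.eq_H_if_corners_eq\<close>).
\<close>

section \<open>The Laplacian as an operator on functions\<close>

definition lap :: "'a pair_pre_digraph \<Rightarrow> ('a \<Rightarrow> real) \<Rightarrow> 'a \<Rightarrow> real" where
  "lap G f a = (\<Sum>b | (a, b) \<in> parcs G. f a - f b)"

definition dirichlet :: "'a pair_pre_digraph \<Rightarrow> ('a \<Rightarrow> real) \<Rightarrow> ('a \<Rightarrow> real) \<Rightarrow> real" where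
  "dirichlet G f h = (\<Sum>a\<in>pverts G. h a * lap G f a)"

context pair_graph
begin

lemma nbrs_subset: "{b. (a, b) \<in> parcs G} \<subseteq> pverts G"
  by (auto dest: in_arcsD2)

lemma finite_nbrs [simp]: "finite {b. (a, b) \<in> parcs G}"
  using nbrs_subset pair_finite_verts by (rule finite_subset)

lemma sum_arcs: "(\<Sum>a\<in>pverts G. \<Sum>b | (a, b) \<in> parcs G. F a b) = (\<Sum>(a, b)\<in>parcs G. F a b)"
proof -
  have "(SIGMA a:pverts G. {b. (a, b) \<in> parcs G}) = parcs G"
    by (auto dest: in_arcsD1)
  then show ?thesis
    using sum.Sigma[of "pverts G" "\<lambda>a. {b. (a, b) \<in> parcs G}" F] pair_finite_verts by simp
qed

lemma sum_arcs_swap: "(\<Sum>(a, b)\<in>parcs G. F a b) = (\<Sum>(a, b)\<in>parcs G. F b a)"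
  by (rule sum.reindex_bij_witness[of _ prod.swap prod.swap]) (auto intro: arcs_symmetric)

text \<open>
  Every edge occurs in \<open>parcs G\<close> in both orientations, whence the division by \<open>2\<close>.  This form shows that
  the Dirichlet form is symmetric and nonnegative, and that it vanishes only on functions which are
  constant along edges.
\<close>
lemma dirichlet_arcs: "dirichlet G f h = (\<Sum>(a, b)\<in>parcs G. (f a - f b) * (h a - h b)) / 2"
proof -
  have 1: "dirichlet G f h = (\<Sum>(a, b)\<in>parcs G. (f a - f b) * h a)"
    unfolding dirichlet_def lap_def sum_distrib_left sum_arcs
    by (intro sum.cong) (auto simp: mult.commute)
  have 2: "dirichlet G f h = (\<Sum>(a, b)\<in>parcs G. (f b - f a) * h b)"
    unfolding 1 by (rule sum_arcs_swap)
  have "dirichlet G f h + dirichlet G f h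
      = (\<Sum>(a, b)\<in>parcs G. (f a - f b) * h a) + (\<Sum>(a, b)\<in>parcs G. (f b - f a) * h b)"
    using 1 2 by linarith
  also have "\<dots> = (\<Sum>(a, b)\<in>parcs G. (f a - f b) * (h a - h b))"
    unfolding sum.distrib[symmetric] by (rule sum.cong) (auto simp: algebra_simps)
  finally have "dirichlet G f h + dirichlet G f h = (\<Sum>(a, b)\<in>parcs G. (f a - f b) * (h a - h b))" .
  then show ?thesis by simp
qed

lemma dirichlet_commute: "dirichlet G f h = dirichlet G h f"
  unfolding dirichlet_arcs by (simp add: mult.commute)

lemma lap_linear: "lap G (\<lambda>x. s * f x + t * g x) a = s * lap G f a + t * lap G g a"
  unfolding lap_def sum_distrib_left by (simp add: algebra_simps flip: sum.distrib)

lemma sum_lap: "(\<Sum>a\<in>pverts G. lap G f a) = 0"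
proof -
  have "(\<Sum>a\<in>pverts G. lap G f a) = dirichlet G f (\<lambda>_. 1)" by (simp add: dirichlet_def)
  also have "\<dots> = 0" by (simp add: dirichlet_arcs)
  finally show ?thesis .
qed

lemma dirichlet_linear_left:
  "dirichlet G (\<lambda>x. s * f x + t * g x) h = s * dirichlet G f h + t * dirichlet G g h"
  unfolding dirichlet_def lap_linear
  by (simp add: algebra_simps sum_distrib_left sum.distrib)

lemma dirichlet_linear_right:
  "dirichlet G h (\<lambda>x. s * f x + t * g x) = s * dirichlet G h f + t * dirichlet G h g"
  using dirichlet_linear_left dirichlet_commute by metis

lemma dirichlet_nonneg: "dirichlet G f f \<ge> 0"
  unfolding dirichlet_arcs by (auto intro!: sum_nonneg divide_nonneg_nonneg)

text \<open>
  Connectedness in the form in which it is used: a set of vertices that no arc leaves and that contains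
  one vertex contains them all.
\<close>
lemma connected_mem_closed_set:
  assumes "Digraph_Component.connected (with_proj G)" "a \<in> pverts G" "b \<in> pverts G"
    and "a \<in> S" and closed: "\<And>x y. x \<in> S \<Longrightarrow> (x, y) \<in> parcs G \<Longrightarrow> y \<in> S"
  shows "b \<in> S"
proof -
  have arcs: "parcs (mk_symmetric (with_proj G)) = parcs G"
    by (auto simp: mk_symmetric_def intro: arcs_symmetric)
  have verts: "pverts (mk_symmetric (with_proj G)) = pverts G"
    by (simp add: mk_symmetric_def)
  have "(a, b) \<in> rtrancl_on (pverts G) (parcs G)"
    using assms(1-3) unfolding Digraph_Component.connected_def strongly_connected_def
    by (auto simp: reachable_def arcs verts)
  then show ?thesis
    by (induction rule: rtrancl_on_induct) (use assms(4) closed in auto)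
qed

lemma dirichlet_eq_0:
  assumes "Digraph_Component.connected (with_proj G)" "dirichlet G f f = 0"
    and "a \<in> pverts G" "b \<in> pverts G"
  shows "f a = f b"
proof -
  have "\<forall>e\<in>parcs G. (case e of (a, b) \<Rightarrow> (f a - f b) * (f a - f b)) = 0"
    using assms(2) pair_finite_arcs unfolding dirichlet_arcs
    by (subst (asm) divide_eq_0_iff, subst (asm) sum_nonneg_eq_0_iff) auto
  then have const: "f x = f y" if "(x, y) \<in> parcs G" for x y
    using that by fastforce
  have "b \<in> {x. f x = f a}"
    using assms(1,3,4) by (rule connected_mem_closed_set) (auto dest: const)
  then show ?thesis by simp
qed

lemma out_degree_conv: "out_degree (with_proj G) a = card {b. (a, b) \<in> parcs G}"
proof -
  have "out_arcs (with_proj G) a = Pair a ` {b. (a, b) \<in> parcs G}"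
    by (auto simp: out_arcs_def)
  then show ?thesis by (simp add: out_degree_def card_image inj_on_def)
qed

lemma laplacian_mat_mult_vec:
  assumes vs: "distinct vs" "set vs = pverts G" and i: "i < length vs"
  shows "(laplacian_mat G vs *\<^sub>v Matrix.vec (length vs) (\<lambda>i. f (vs ! i))) $ i = lap G f (vs ! i)"
proof -
  have "(laplacian_mat G vs *\<^sub>v Matrix.vec (length vs) (\<lambda>i. f (vs ! i))) $ i
      = (\<Sum>j<length vs. laplacian_mat G vs $$ (i, j) * f (vs ! j))"
    using i carrier_matD[OF laplacian_mat_carrier[of G vs]]
    by (simp add: scalar_prod_def lessThan_atLeast0)
  also have "\<dots> = (\<Sum>j<length vs. (if vs ! i = vs ! j then real (out_degree (with_proj G) (vs ! i)) else 0) * f (vs ! j)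
      - (if (vs ! i, vs ! j) \<in> parcs G then 1 else 0) * f (vs ! j))"
    using i vs(1) by (intro sum.cong) (auto simp: laplacian_mat_index nth_eq_iff_index_eq algebra_simps)
  also have "\<dots> = (\<Sum>b\<in>pverts G. (if vs ! i = b then real (out_degree (with_proj G) (vs ! i)) else 0) * f b
      - (if (vs ! i, b) \<in> parcs G then 1 else 0) * f b)"
    using sum.reindex_bij_betw[OF bij_betw_nth[OF vs(1) refl vs(2)[symmetric]]] by simp
  also have "\<dots> = (\<Sum>b\<in>pverts G. if vs ! i = b then real (out_degree (with_proj G) (vs ! i)) * f b else 0)
      - (\<Sum>b\<in>pverts G. if (vs ! i, b) \<in> parcs G then f b else 0)"
    unfolding sum_subtractf by (intro arg_cong2[of _ _ _ _ "(-)"] sum.cong) auto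
  also have "(\<Sum>b\<in>pverts G. if vs ! i = b then real (out_degree (with_proj G) (vs ! i)) * f b else 0)
      = real (card {b. (vs ! i, b) \<in> parcs G}) * f (vs ! i)"
    using i vs pair_finite_verts nth_mem[OF i] by (simp add: out_degree_conv)
  also have "(\<Sum>b\<in>pverts G. if (vs ! i, b) \<in> parcs G then f b else 0) = (\<Sum>b | (vs ! i, b) \<in> parcs G. f b)"
    using nbrs_subset[of "vs ! i"] pair_finite_verts
    by (simp add: sum.If_cases Int_absorb1)
  finally show ?thesis by (simp add: lap_def sum_subtractf)
qed

lemma in_laplacian_spectrum:
  assumes eig: "\<And>a. a \<in> pverts G \<Longrightarrow> lap G f a = \<rho> * f a" and nz: "a \<in> pverts G" "f a \<noteq> 0"
  shows "\<rho> \<in># laplacian_spectrum G"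
proof -
  obtain vs where vs: "distinct vs" "set vs = pverts G"
    using finite_distinct_list[OF pair_finite_verts] by blast
  define A where "A = laplacian_mat G vs"
  define m where "m = length vs"
  define v where "v = Matrix.vec m (\<lambda>i. f (vs ! i))"
  have A: "A \<in> carrier_mat m m" by (simp add: A_def m_def)
  obtain k where k: "k < m" "vs ! k = a" using nz vs by (metis in_set_conv_nth m_def)
  have "v \<noteq> 0\<^sub>v m"
  proof
    assume "v = 0\<^sub>v m"
    then have "v $ k = 0" using k by simp
    then show False using k nz by (simp add: v_def)
  qed
  moreover have "A *\<^sub>v v = \<rho> \<cdot>\<^sub>v v"
  proof (rule eq_vecI)
    fix i assume "i < dim_vec (\<rho> \<cdot>\<^sub>v v)"
    then have i: "i < m" by (simp add: v_def)
    then have "vs ! i \<in> pverts G" using nth_mem[of i vs] vs(2) by (simp add: m_def)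
    then show "(A *\<^sub>v v) $ i = (\<rho> \<cdot>\<^sub>v v) $ i"
      using laplacian_mat_mult_vec[OF vs, of i f] i eig by (simp add: A_def v_def m_def)
  qed (use A in \<open>simp add: v_def\<close>)
  ultimately have "eigenvalue A \<rho>"
    using A unfolding eigenvalue_def eigenvector_def by (intro exI[of _ v]) (simp add: v_def)
  then have "poly (char_poly A) \<rho> = 0" using eigenvalue_root_char_poly[OF A] by simp
  moreover have "char_poly A \<noteq> 0" using degree_monic_char_poly[OF A] by auto
  ultimately show ?thesis by (simp add: laplacian_spectrum_eq[OF vs] A_def)
qed

end

text \<open>
  An upper bound for the second smallest eigenvalue from two distinct eigenvalues, whatever their
  multiplicities.
\<close>
lemma sorted_list_of_multiset_nth_1_le:
  fixes M :: "'b::linorder multiset"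
  assumes "a \<in># M" "b \<in># M" "a < b"
  shows "sorted_list_of_multiset M ! 1 \<le> b"
proof -
  define xs where "xs = sorted_list_of_multiset M"
  have s: "sorted xs" by (simp add: xs_def)
  have "a \<in> set xs" "b \<in> set xs" using assms by (simp_all add: xs_def)
  then obtain i j where ij: "i < length xs" "xs ! i = a" "j < length xs" "xs ! j = b"
    by (auto simp: in_set_conv_nth)
  have "i < j"
  proof (rule ccontr)
    assume "\<not> i < j"
    then show False using sorted_nth_mono[OF s, of j i] ij assms(3) by auto
  qed
  then show ?thesis using sorted_nth_mono[OF s, of 1 j] ij by (simp add: xs_def)
qed

lemma monic_eq_prod_proots:
  fixes p :: "'b::field poly"
  assumes "monic p" "size (proots p) = degree p" "mset es = proots p"
  shows "p = (\<Prod>e\<leftarrow>es. [:- e, 1:])"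
  using assms
proof (induction es arbitrary: p)
  case Nil
  then have "degree p = 0" "lead_coeff p = 1" by auto
  then show ?case by (auto elim!: degree_eq_zeroE)
next
  case (Cons e es)
  have "p \<noteq> 0" using Cons.prems(1) by auto
  have "e \<in># proots p" using Cons.prems(3)[symmetric] by simp
  then have "poly p e = 0" using \<open>p \<noteq> 0\<close> by simp
  then obtain q where q: "p = [:- e, 1:] * q" by (auto simp: poly_eq_0_iff_dvd elim: dvdE)
  have "q \<noteq> 0" using q \<open>p \<noteq> 0\<close> by auto
  have "proots p = {#e#} + proots q"
    using proots_mult[of "[:- e, 1:]" q] \<open>q \<noteq> 0\<close> by (simp only: q) simp
  moreover have "degree p = Suc (degree q)" using \<open>q \<noteq> 0\<close> q degree_mult_eq[of "[:- e, 1:]" q] by simp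
  moreover have "lead_coeff q = 1" using Cons.prems(1) lead_coeff_mult[of "[:- e, 1:]" q] by (simp only: q) simp
  ultimately have "q = (\<Prod>e\<leftarrow>es. [:- e, 1:])"
    using Cons.prems by (intro Cons.IH) auto
  then show ?case by (simp only: q list.map prod_list.Cons)
qed

section \<open>Variational description of the algebraic connectivity\<close>

context pair_graph
begin

text \<open>
  The spectrum counts roots of the characteristic polynomial with multiplicity, and a multiple root
  gives only one eigenvector at once.  Triangularising the Laplacian with the eigenvalues in increasing
  order on the diagonal respects multiplicities: the first two columns of the transformation span an invariant plane on which the
  Laplacian acts with the two smallest eigenvalues.
\<close>
lemma triangular_eigenfunctions:
  assumes card: "card (pverts G) \<ge> 2"
  defines "es \<equiv> sorted_list_of_multiset (laplacian_spectrum G)"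
  obtains f g c where
    "\<And>a. a \<in> pverts G \<Longrightarrow> lap G f a = es ! 0 * f a"
    "\<And>a. a \<in> pverts G \<Longrightarrow> lap G g a = c * f a + es ! 1 * g a"
    "\<And>s t. (\<And>a. a \<in> pverts G \<Longrightarrow> s * f a + t * g a = 0) \<Longrightarrow> s = 0 \<and> t = 0"
proof -
  obtain vs where vs: "distinct vs" "set vs = pverts G"
    using finite_distinct_list[OF pair_finite_verts] by blast
  define A where "A = laplacian_mat G vs"
  define m where "m = length vs"
  have m: "m = card (pverts G)" using distinct_card[OF vs(1)] vs(2) by (simp add: m_def)
  have A: "A \<in> carrier_mat m m" by (simp add: A_def m_def)
  have spec: "laplacian_spectrum G = proots (char_poly A)"
    by (simp add: A_def laplacian_spectrum_eq[OF vs])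
  have "char_poly A = (\<Prod>e\<leftarrow>es. [:- e, 1:])"
  proof (rule monic_eq_prod_proots)
    show "monic (char_poly A)" using degree_monic_char_poly[OF A] by simp
    show "size (proots (char_poly A)) = degree (char_poly A)"
      using size_laplacian_spectrum[of G] pair_graph degree_monic_char_poly[OF A] m spec by simp
    show "mset es = proots (char_poly A)" by (simp add: es_def spec)
  qed
  moreover obtain B P Q where "schur_decomposition A es = (B, P, Q)"
    by (cases "schur_decomposition A es") auto
  ultimately have sim: "similar_mat_wit A B P Q" and tri: "upper_triangular B" and diag: "diag_mat B = es"
    using schur_decomposition[OF A] by auto
  from similar_mat_witD2[OF A sim]
  have QP: "Q * P = 1\<^sub>m m" and APQ: "A = P * B * Q"
    and B: "B \<in> carrier_mat m m" and P: "P \<in> carrier_mat m m" and Q: "Q \<in> carrier_mat m m"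
    by auto
  have "A * P = P * B * (Q * P)"
    unfolding APQ using assoc_mult_mat[OF mult_carrier_mat[OF P B] Q P] .
  then have AP: "A * P = P * B" using QP right_mult_one_mat[OF mult_carrier_mat[OF P B]] by simp
  define idx where "idx = the_inv_into {..<m} ((!) vs)"
  have bij: "bij_betw ((!) vs) {..<m} (pverts G)"
    using bij_betw_nth[OF vs(1)] vs(2) by (simp add: m_def)
  have idx: "idx (vs ! i) = i" if "i < m" for i
    unfolding idx_def using that bij by (intro the_inv_into_f_f) (auto simp: bij_betw_def)
  define F where "F k x = P $$ (idx x, k)" for k x
  have vecF: "Matrix.vec m (\<lambda>i. F k (vs ! i)) = col P k" if "k < m" for k
    by (rule eq_vecI) (use that P idx in \<open>auto simp: F_def\<close>)
  have lapF: "lap G (F k) (vs ! i) = (\<Sum>l<m. P $$ (i, l) * B $$ (l, k))" if "i < m" "k < m" for i k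
  proof -
    have "lap G (F k) (vs ! i) = (A *\<^sub>v col P k) $ i"
      using laplacian_mat_mult_vec[OF vs, of i "F k"] that vecF[OF that(2)]
      by (simp add: A_def m_def)
    also have "\<dots> = (A * P) $$ (i, k)" using that A P by simp
    also have "\<dots> = (\<Sum>l<m. P $$ (i, l) * B $$ (l, k))"
      unfolding AP using that P B by (simp add: scalar_prod_def lessThan_atLeast0)
    finally show ?thesis .
  qed
  have Bdiag: "B $$ (k, k) = es ! k" if "k < m" for k
    using that B unfolding diag[symmetric] diag_mat_def by simp
  have B0: "B $$ (l, k) = 0" if "k < l" "l < m" for k l
    using tri that B unfolding upper_triangular_def by auto
  have m2: "0 < m" "1 < m" using card m by auto
  show thesis
  proof (rule that[of "F 0" "F 1" "B $$ (0, 1)"])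
    fix a assume "a \<in> pverts G"
    then obtain i where i: "i < m" "a = vs ! i" using bij by (auto simp: bij_betw_def)
    have "lap G (F 0) a = (\<Sum>l\<in>{0}. P $$ (i, l) * B $$ (l, 0))"
      unfolding i(2) lapF[OF i(1) m2(1)] using m2 B0 by (intro sum.mono_neutral_right) auto
    then show "lap G (F 0) a = es ! 0 * F 0 a" using i m2 by (simp add: F_def idx Bdiag)
    have "lap G (F 1) a = (\<Sum>l\<in>{0,1}. P $$ (i, l) * B $$ (l, 1))"
      unfolding i(2) lapF[OF i(1) m2(2)] using m2 B0 by (intro sum.mono_neutral_right) auto
    then show "lap G (F 1) a = B $$ (0, 1) * F 0 a + es ! 1 * F 1 a"
      using i m2 Bdiag[of 1] by (simp add: F_def idx)
  next
    fix s t assume zero: "\<And>a. a \<in> pverts G \<Longrightarrow> s * F 0 a + t * F 1 a = 0"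
    have QP': "(\<Sum>i<m. Q $$ (k, i) * P $$ (i, l)) = (if k = l then 1 else 0)" if "k < m" "l < m" for k l
    proof -
      have "(\<Sum>i<m. Q $$ (k, i) * P $$ (i, l)) = (Q * P) $$ (k, l)"
        using that P Q by (simp add: scalar_prod_def lessThan_atLeast0)
      then show ?thesis using that QP by simp
    qed
    have "s * (if k = 0 then 1 else 0) + t * (if k = 1 then 1 else 0) = 0" if "k < m" for k
    proof -
      have "s * (\<Sum>i<m. Q $$ (k, i) * P $$ (i, 0)) + t * (\<Sum>i<m. Q $$ (k, i) * P $$ (i, 1))
          = (\<Sum>i<m. Q $$ (k, i) * (s * F 0 (vs ! i) + t * F 1 (vs ! i)))"
        unfolding sum_distrib_left sum.distrib[symmetric]
        by (intro sum.cong) (simp_all add: F_def idx algebra_simps)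
      also have "\<dots> = 0"
        using zero bij by (intro sum.neutral) (auto simp: bij_betw_def)
      finally show ?thesis using QP'[OF that m2(1)] QP'[OF that m2(2)] by simp
    qed
    from this[of 0] this[of 1] m2 show "s = 0 \<and> t = 0" by simp
  qed
qed

text \<open>
  Half of the Courant-Fischer principle: on the plane of the two smallest eigenvalues the Rayleigh
  quotient is at most the second one.
\<close>
lemma test_function_below_algebraic_connectivity:
  assumes card: "card (pverts G) \<ge> 2"
  obtains f where "\<exists>a\<in>pverts G. f a \<noteq> 0" "(\<Sum>a\<in>pverts G. f a) = 0"
    "dirichlet G f f \<le> algebraic_connectivity G * (\<Sum>a\<in>pverts G. (f a)\<^sup>2)"
proof -
  define es where "es = sorted_list_of_multiset (laplacian_spectrum G)"
  define \<mu> \<nu> where "\<mu> = es ! 0" and "\<nu> = es ! 1"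
  have "length es = card (pverts G)"
    using size_laplacian_spectrum[of G] pair_graph
    by (metis es_def mset_sorted_list_of_multiset size_mset)
  then have le: "\<mu> \<le> \<nu>"
    unfolding \<mu>_def \<nu>_def using card by (intro sorted_nth_mono) (auto simp: es_def)
  obtain f g c where f: "\<And>a. a \<in> pverts G \<Longrightarrow> lap G f a = \<mu> * f a"
    and g: "\<And>a. a \<in> pverts G \<Longrightarrow> lap G g a = c * f a + \<nu> * g a"
    and indep: "\<And>s t. (\<And>a. a \<in> pverts G \<Longrightarrow> s * f a + t * g a = 0) \<Longrightarrow> s = 0 \<and> t = 0"
    using triangular_eigenfunctions[OF card] unfolding \<mu>_def \<nu>_def es_def by metis
  define ip where "ip h k = (\<Sum>a\<in>pverts G. h a * k a)" for h k :: "'a \<Rightarrow> real"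
  have ip_commute: "ip h k = ip k h" for h k by (simp add: ip_def mult.commute)
  have ip_lin: "ip h (\<lambda>x. s * k x + t * l x) = s * ip h k + t * ip h l" for h k l s t
    by (simp add: ip_def sum_distrib_left algebra_simps sum.distrib)
  have ip_0: "a \<in> pverts G \<Longrightarrow> h a = 0" if "ip h h = 0" for h a
    using that pair_finite_verts unfolding ip_def by (subst (asm) sum_nonneg_eq_0_iff) auto
  have ff: "ip f f \<noteq> 0"
  proof
    assume "ip f f = 0"
    then have "1 = (0::real) \<and> 0 = (0::real)" by (intro indep) (auto dest: ip_0)
    then show False by simp
  qed
  \<comment> \<open>Make the second function orthogonal to the first.  By symmetry of the Laplacian this also removes
     the off-diagonal coefficient, so that both become eigenfunctions.\<close>
  define t where "t = ip f g / ip f f"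
  define h where "h = (\<lambda>x. 1 * g x + (- t) * f x)"
  have fh: "ip f h = 0" unfolding h_def ip_lin using ff by (simp add: t_def)
  define c' where "c' = c + t * \<nu> - t * \<mu>"
  have lap_h: "lap G h a = c' * f a + \<nu> * h a" if "a \<in> pverts G" for a
    unfolding h_def lap_linear c'_def f[OF that] g[OF that] by (simp add: algebra_simps)
  have Dff: "dirichlet G f k = \<mu> * ip f k" for k
    unfolding dirichlet_def ip_def sum_distrib_left by (intro sum.cong) (auto simp: f)
  have Dh: "dirichlet G h k = c' * ip f k + \<nu> * ip h k" for k
    unfolding dirichlet_def ip_def sum_distrib_left sum.distrib[symmetric]
    by (intro sum.cong) (auto simp: lap_h algebra_simps)
  have "c' * ip f f + \<nu> * ip h f = \<mu> * ip f h"
    using dirichlet_commute[of f h] by (simp add: Dff Dh)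
  then have c': "c' = 0" using fh ff ip_commute[of h f] by simp
  \<comment> \<open>A plane meets the hyperplane of functions with mean zero.\<close>
  define sum1 where "sum1 k = (\<Sum>a\<in>pverts G. k a)" for k :: "'a \<Rightarrow> real"
  obtain \<alpha> \<beta> where ab: "\<alpha> * sum1 f + \<beta> * sum1 h = 0" "\<alpha> \<noteq> 0 \<or> \<beta> \<noteq> 0"
  proof (cases "sum1 f = 0")
    case True then show ?thesis by (intro that[of 1 0]) auto
  next
    case False then show ?thesis by (intro that[of "sum1 h" "- sum1 f"]) (auto simp: algebra_simps)
  qed
  define k where "k = (\<lambda>x. \<alpha> * f x + \<beta> * h x)"
  show thesis
  proof (rule that[of k])
    show "\<exists>a\<in>pverts G. k a \<noteq> 0"
    proof (rule ccontr)
      assume "\<not> ?thesis"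
      then have "(\<alpha> - \<beta> * t) * f a + \<beta> * g a = 0" if "a \<in> pverts G" for a
        using that by (auto simp: k_def h_def algebra_simps)
      then have "\<alpha> - \<beta> * t = 0 \<and> \<beta> = 0" by (rule indep)
      then show False using ab(2) by auto
    qed
    show "(\<Sum>a\<in>pverts G. k a) = 0"
      using ab(1) unfolding k_def sum1_def by (simp add: sum.distrib sum_distrib_left)
    have hf: "ip h f = 0" using fh ip_commute by simp
    have "dirichlet G k k = \<alpha>\<^sup>2 * (\<mu> * ip f f) + \<beta>\<^sup>2 * (\<nu> * ip h h)"
      unfolding k_def dirichlet_linear_left dirichlet_linear_right Dff Dh c'
      by (simp add: fh hf power2_eq_square algebra_simps)
    also have "\<dots> \<le> \<alpha>\<^sup>2 * (\<nu> * ip f f) + \<beta>\<^sup>2 * (\<nu> * ip h h)"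
      using le by (intro add_mono mult_left_mono mult_right_mono) (auto simp: ip_def sum_nonneg)
    finally have upper: "dirichlet G k k \<le> \<alpha>\<^sup>2 * (\<nu> * ip f f) + \<beta>\<^sup>2 * (\<nu> * ip h h)" .
    have "ip k k = \<alpha>\<^sup>2 * ip f f + \<beta>\<^sup>2 * ip h h"
      using ip_commute[of k f] ip_commute[of k h] ip_lin[of k \<alpha> f \<beta> h] ip_lin[of f \<alpha> f \<beta> h] ip_lin[of h \<alpha> f \<beta> h]
      by (simp add: k_def[symmetric] fh hf power2_eq_square)
    then have "\<alpha>\<^sup>2 * (\<nu> * ip f f) + \<beta>\<^sup>2 * (\<nu> * ip h h) = \<nu> * ip k k"
      by (simp add: algebra_simps)
    with upper show "dirichlet G k k \<le> algebraic_connectivity G * (\<Sum>a\<in>pverts G. (k a)\<^sup>2)"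
      by (simp add: algebraic_connectivity_def \<nu>_def es_def ip_def power2_eq_square)
  qed
qed

text \<open>
  The Rayleigh quotient attains its minimum over the functions with mean zero, by compactness of the
  unit sphere.  Functions are extended by \<open>0\<close> outside the vertices; the sphere is then a closed
  subset of a product of compact intervals and points, which is compact by Tychonoff's theorem.
\<close>
lemma dirichlet_minimiser:
  assumes card: "card (pverts G) \<ge> 2"
  obtains \<rho> f where "\<exists>a\<in>pverts G. f a \<noteq> 0" "(\<Sum>a\<in>pverts G. f a) = 0"
    "dirichlet G f f = \<rho> * (\<Sum>a\<in>pverts G. (f a)\<^sup>2)"
    "\<And>g. (\<Sum>a\<in>pverts G. g a) = 0 \<Longrightarrow> \<rho> * (\<Sum>a\<in>pverts G. (g a)\<^sup>2) \<le> dirichlet G g g"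
proof -
  define V where "V = pverts G"
  have finV: "finite V" by (simp add: V_def pair_finite_verts)
  define K where "K = PiE UNIV (\<lambda>a. if a \<in> V then {-1..1::real} else {0})"
  define S where "S = K \<inter> {f. (\<Sum>a\<in>V. f a) = 0} \<inter> {f. (\<Sum>a\<in>V. (f a)\<^sup>2) = 1}"
  have "compactin (product_topology (\<lambda>_. euclidean) UNIV) K"
    unfolding K_def compactin_PiE by simp
  then have "compact K" by (simp add: euclidean_product_topology)
  have coord: "continuous_on UNIV (\<lambda>f. (f a :: real))" for a :: 'a by simp
  have "closed {f. (\<Sum>a\<in>V. f a) = (0::real)}"
    by (rule closed_Collect_eq) (intro continuous_intros coord)+
  moreover have "closed {f. (\<Sum>a\<in>V. (f a)\<^sup>2) = (1::real)}"
    by (rule closed_Collect_eq) (intro continuous_intros coord)+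
  ultimately have "compact S"
    unfolding S_def using \<open>compact K\<close> by (intro compact_Int_closed)
  have inK: "f \<in> K" if "\<And>a. a \<notin> V \<Longrightarrow> f a = 0" "(\<Sum>a\<in>V. (f a)\<^sup>2) = 1" for f
  proof -
    have "f a \<in> {-1..1}" if "a \<in> V" for a
    proof -
      have "(f a)\<^sup>2 \<le> (\<Sum>a\<in>V. (f a)\<^sup>2)"
        using finV that by (intro member_le_sum) auto
      then have "\<bar>f a\<bar> \<le> 1" using \<open>(\<Sum>a\<in>V. (f a)\<^sup>2) = 1\<close> by (simp add: abs_square_le_1)
      then show ?thesis by auto
    qed
    then show ?thesis using that(1) by (auto simp: K_def PiE_iff)
  qed
  have normalise: "\<exists>f\<in>S. dirichlet G g g = dirichlet G f f * (\<Sum>a\<in>V. (g a)\<^sup>2)"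
    if zero: "(\<Sum>a\<in>V. g a) = 0" and nz: "(\<Sum>a\<in>V. (g a)\<^sup>2) \<noteq> 0" for g
  proof -
    define r where "r = (\<Sum>a\<in>V. (g a)\<^sup>2)"
    have r: "r > 0" using nz unfolding r_def by (simp add: sum_nonneg less_le)
    define f where "f = (\<lambda>a. if a \<in> V then g a / sqrt r else 0)"
    have "(\<Sum>a\<in>V. f a) = (\<Sum>a\<in>V. g a) / sqrt r"
      unfolding f_def by (simp add: sum_divide_distrib)
    then have "(\<Sum>a\<in>V. f a) = 0" using zero by simp
    moreover have "(\<Sum>a\<in>V. (f a)\<^sup>2) = r / r"
      unfolding f_def using r by (simp add: power_divide r_def[symmetric] flip: sum_divide_distrib)
    ultimately have "f \<in> S" using r inK[of f] by (simp add: S_def f_def)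
    have "dirichlet G f f = dirichlet G g g / r"
      unfolding dirichlet_arcs sum_divide_distrib
      using r by (intro sum.cong) (auto simp: f_def V_def field_simps dest: in_arcsD1 in_arcsD2)
    then show ?thesis using \<open>f \<in> S\<close> r by (intro bexI[of _ f]) (auto simp: r_def)
  qed
  \<comment> \<open>The sphere is not empty because there are two vertices.\<close>
  obtain a0 b0 where ab: "a0 \<in> V" "b0 \<in> V" "a0 \<noteq> b0"
    using card unfolding V_def numeral_2_eq_2 by (auto simp: card_le_Suc_iff)
  define g0 where "g0 = (\<lambda>a. if a = a0 then 1 else if a = b0 then -1 else (0::real))"
  have "(\<Sum>a\<in>V. g0 a) = (\<Sum>a\<in>{a0, b0}. g0 a)"
    using ab finV by (intro sum.mono_neutral_right) (auto simp: g0_def)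
  then have "(\<Sum>a\<in>V. g0 a) = 0" using ab by (simp add: g0_def)
  moreover have "(\<Sum>a\<in>V. (g0 a)\<^sup>2) \<noteq> 0"
    using ab finV by (subst sum_nonneg_eq_0_iff) (auto simp: g0_def)
  ultimately have "S \<noteq> {}" using normalise by blast
  moreover have "continuous_on S (\<lambda>f. dirichlet G f f)"
    unfolding dirichlet_def lap_def
    by (intro continuous_intros continuous_on_subset[OF coord]) auto
  ultimately obtain f where f: "f \<in> S" "\<And>g. g \<in> S \<Longrightarrow> dirichlet G f f \<le> dirichlet G g g"
    using continuous_attains_inf[OF \<open>compact S\<close>, of "\<lambda>f. dirichlet G f f"] by auto
  show thesis
  proof (rule that[of f "dirichlet G f f"])
    show "\<exists>a\<in>pverts G. f a \<noteq> 0"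
    proof (rule ccontr)
      assume "\<not> ?thesis"
      then have "(\<Sum>a\<in>V. (f a)\<^sup>2) = 0" by (simp add: V_def)
      then show False using f(1) by (simp add: S_def)
    qed
  next
    fix g :: "'a \<Rightarrow> real" assume g: "(\<Sum>a\<in>pverts G. g a) = 0"
    show "dirichlet G f f * (\<Sum>a\<in>pverts G. (g a)\<^sup>2) \<le> dirichlet G g g"
    proof (cases "(\<Sum>a\<in>pverts G. (g a)\<^sup>2) = 0")
      case True
      then show ?thesis by (simp add: dirichlet_nonneg)
    next
      case False
      then obtain f' where "f' \<in> S" "dirichlet G g g = dirichlet G f' f' * (\<Sum>a\<in>V. (g a)\<^sup>2)"
        using normalise[of g] g by (auto simp: V_def)
      then show ?thesis using f(2)[of f'] by (simp add: V_def mult_right_mono sum_nonneg)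
    qed
  qed (use f(1) in \<open>simp_all add: S_def V_def\<close>)
qed

text \<open>
  First variation: perturb \<open>f\<close> in the direction \<open>h = lap G f - \<rho> f\<close>, which again has mean zero.  The
  derivative of the quadratic functional \<open>dirichlet G f f - \<rho> \<Sum> f\<^sup>2\<close> in this direction is twice
  the squared norm of \<open>h\<close>, and it has to vanish at a minimum.
\<close>
lemma minimiser_imp_eigenfunction:
  assumes bound: "\<And>g. (\<Sum>a\<in>pverts G. g a) = 0 \<Longrightarrow> \<rho> * (\<Sum>a\<in>pverts G. (g a)\<^sup>2) \<le> dirichlet G g g"
    and f: "(\<Sum>a\<in>pverts G. f a) = 0" "dirichlet G f f \<le> \<rho> * (\<Sum>a\<in>pverts G. (f a)\<^sup>2)"
    and a: "a \<in> pverts G"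
  shows "lap G f a = \<rho> * f a"
proof -
  define h where "h a = lap G f a - \<rho> * f a" for a
  define N where "N = (\<Sum>a\<in>pverts G. (h a)\<^sup>2)"
  define C where "C = dirichlet G h h - \<rho> * N"
  have h0: "(\<Sum>a\<in>pverts G. h a) = 0"
    unfolding h_def sum_subtractf sum_distrib_left[symmetric] sum_lap f(1) by simp
  have eq: "dirichlet G f f = \<rho> * (\<Sum>a\<in>pverts G. (f a)\<^sup>2)"
    using bound[OF f(1)] f(2) by simp
  have N: "dirichlet G f h - \<rho> * (\<Sum>a\<in>pverts G. f a * h a) = N"
    unfolding dirichlet_def N_def sum_distrib_left sum_subtractf[symmetric]
    by (intro sum.cong) (auto simp: h_def power2_eq_square algebra_simps)
  have quad: "0 \<le> 2 * t * N + t\<^sup>2 * C" for t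
  proof -
    define g where "g = (\<lambda>a. 1 * f a + t * h a)"
    have "(\<Sum>a\<in>pverts G. g a) = 0"
      unfolding g_def sum.distrib sum_distrib_left[symmetric] f(1) h0 by simp
    then have "\<rho> * (\<Sum>a\<in>pverts G. (g a)\<^sup>2) \<le> dirichlet G g g" by (rule bound)
    moreover have "dirichlet G g g = dirichlet G f f + 2 * t * dirichlet G f h + t\<^sup>2 * dirichlet G h h"
      unfolding g_def dirichlet_linear_left dirichlet_linear_right dirichlet_commute[of h f]
      by (simp add: power2_eq_square algebra_simps)
    moreover have "(\<Sum>a\<in>pverts G. (g a)\<^sup>2)
        = (\<Sum>a\<in>pverts G. (f a)\<^sup>2) + 2 * t * (\<Sum>a\<in>pverts G. f a * h a) + t\<^sup>2 * N"
      unfolding N_def sum_distrib_left sum.distrib[symmetric] g_def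
      by (intro sum.cong) (auto simp: power2_eq_square algebra_simps)
    ultimately show ?thesis
      using eq unfolding N[symmetric] C_def by (simp add: algebra_simps)
  qed
  have "N = 0"
  proof (rule ccontr)
    assume "N \<noteq> 0"
    then have "N > 0" by (simp add: N_def sum_nonneg less_le)
    \<comment> \<open>A negative step so small that the quadratic term cannot compensate the linear one.\<close>
    define t where "t = - N / (\<bar>C\<bar> + 1)"
    have t: "t < 0" using \<open>N > 0\<close> by (simp add: t_def divide_neg_pos)
    have "t * C \<ge> - N"
    proof -
      have "\<bar>t * C\<bar> = N * (\<bar>C\<bar> / (\<bar>C\<bar> + 1))" using \<open>N > 0\<close> by (simp add: t_def abs_mult)
      also have "\<dots> \<le> N * 1" using \<open>N > 0\<close> by (intro mult_left_mono) auto
      finally show ?thesis by linarith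
    qed
    then have "2 * N + t * C > 0" using \<open>N > 0\<close> by linarith
    then have "t * (2 * N + t * C) < 0" using t by (simp add: mult_neg_pos)
    then show False using quad[of t] by (simp add: power2_eq_square algebra_simps)
  qed
  then have "(h a)\<^sup>2 = 0"
    using a pair_finite_verts unfolding N_def by (subst (asm) sum_nonneg_eq_0_iff) auto
  then show ?thesis by (simp add: h_def)
qed

text \<open>
  The other half of the Courant-Fischer principle.  The minimum \<open>\<rho>\<close> of the Rayleigh quotient over mean
  zero functions is an eigenvalue, and for a connected graph it differs from the eigenvalue \<open>0\<close> of the
  constants; so the second smallest eigenvalue is at most \<open>\<rho>\<close>.
\<close>
lemma connected_spectral_gap:
  assumes conn: "Digraph_Component.connected (with_proj G)" and card: "card (pverts G) \<ge> 2"
  obtains \<rho> where "0 < \<rho>" "algebraic_connectivity G \<le> \<rho>"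
    "\<And>g. (\<Sum>a\<in>pverts G. g a) = 0 \<Longrightarrow> \<rho> * (\<Sum>a\<in>pverts G. (g a)\<^sup>2) \<le> dirichlet G g g"
proof -
  obtain \<rho> f where f: "\<exists>a\<in>pverts G. f a \<noteq> 0" "(\<Sum>a\<in>pverts G. f a) = 0"
    "dirichlet G f f = \<rho> * (\<Sum>a\<in>pverts G. (f a)\<^sup>2)"
    and bound: "\<And>g. (\<Sum>a\<in>pverts G. g a) = 0 \<Longrightarrow> \<rho> * (\<Sum>a\<in>pverts G. (g a)\<^sup>2) \<le> dirichlet G g g"
    by (rule dirichlet_minimiser[OF card]) (rule that)
  obtain a where a: "a \<in> pverts G" "f a \<noteq> 0" using f(1) by blast
  have "dirichlet G f f \<noteq> 0"
  proof
    assume "dirichlet G f f = 0"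
    then have "f b = f a" if "b \<in> pverts G" for b
      using dirichlet_eq_0[OF conn] a that by blast
    then have "(\<Sum>b\<in>pverts G. f b) = card (pverts G) * f a" by simp
    then show False using f(2) a card by simp
  qed
  then have "\<rho> * (\<Sum>a\<in>pverts G. (f a)\<^sup>2) > 0" using f(3) dirichlet_nonneg[of f] by linarith
  then have pos: "0 < \<rho>" by (simp add: zero_less_mult_iff sum_nonneg leD)
  have "\<rho> \<in># laplacian_spectrum G"
    using minimiser_imp_eigenfunction[OF bound f(2)] f(3) a by (intro in_laplacian_spectrum[of f]) auto
  moreover have "0 \<in># laplacian_spectrum G"
    using a(1) by (intro in_laplacian_spectrum[of "\<lambda>_. 1"]) (auto simp: lap_def)
  ultimately have "algebraic_connectivity G \<le> \<rho>"
    unfolding algebraic_connectivity_def using pos by (intro sorted_list_of_multiset_nth_1_le)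
  then show thesis using pos bound by (intro that)
qed

end

section \<open>Rearrangement by double summation by parts\<close>

definition corner :: "(nat \<Rightarrow> nat \<Rightarrow> real) \<Rightarrow> nat \<Rightarrow> nat \<Rightarrow> real" where
  "corner A i j = (\<Sum>k=1..i. \<Sum>l=1..j. A k l)"

lemma corner_transpose: "corner (\<lambda>i j. A j i) i j = corner A j i"
  unfolding corner_def by (rule sum.swap)

lemma summation_by_parts:
  fixes d u :: "nat \<Rightarrow> real"
  shows "(\<Sum>i=1..n. d i * u i) =
    (\<Sum>i=1..<n. (\<Sum>k=1..i. d k) * (u i - u (Suc i))) + (\<Sum>k=1..n. d k) * u n"
proof (induction n)
  case (Suc n)
  show ?case
  proof (cases "n = 0")
    case False
    then have "(\<Sum>i=1..<Suc n. (\<Sum>k=1..i. d k) * (u i - u (Suc i))) =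
      (\<Sum>i=1..<n. (\<Sum>k=1..i. d k) * (u i - u (Suc i))) + (\<Sum>k=1..n. d k) * (u n - u (Suc n))"
      by simp
    with Suc show ?thesis by (simp add: algebra_simps)
  qed simp
qed simp

text \<open>
  Vanishing row and column sums remove all boundary terms.
\<close>
lemma double_summation_by_parts:
  fixes D :: "nat \<Rightarrow> nat \<Rightarrow> real"
  assumes rows: "\<And>i. i \<in> {1..n} \<Longrightarrow> (\<Sum>j=1..n. D i j) = 0"
    and cols: "\<And>j. j \<in> {1..n} \<Longrightarrow> (\<Sum>i=1..n. D i j) = 0"
  shows "(\<Sum>i=1..n. \<Sum>j=1..n. D i j * (u i * v j)) =
    (\<Sum>i=1..<n. \<Sum>j=1..<n. corner D i j * ((u i - u (Suc i)) * (v j - v (Suc j))))"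
proof -
  define R where "R i j = (\<Sum>l=1..j. D i l)" for i j
  have row: "(\<Sum>j=1..n. D i j * v j) = (\<Sum>j=1..<n. R i j * (v j - v (Suc j)))" if "i \<in> {1..n}" for i
    using summation_by_parts[of "D i" v n] rows[OF that] by (simp add: R_def)
  have col: "(\<Sum>i=1..n. R i j * u i) = (\<Sum>i=1..<n. corner D i j * (u i - u (Suc i)))" if "j \<in> {1..<n}" for j
  proof -
    have "(\<Sum>i=1..n. R i j) = (\<Sum>l=1..j. \<Sum>i=1..n. D i l)"
      unfolding R_def by (rule sum.swap)
    also have "\<dots> = 0" using that by (intro sum.neutral ballI cols) auto
    finally show ?thesis using summation_by_parts[of "\<lambda>i. R i j" u n] by (simp add: corner_def R_def)
  qed
  have "(\<Sum>i=1..n. \<Sum>j=1..n. D i j * (u i * v j)) = (\<Sum>i=1..n. u i * (\<Sum>j=1..n. D i j * v j))"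
    by (simp add: sum_distrib_left algebra_simps)
  also have "\<dots> = (\<Sum>i=1..n. u i * (\<Sum>j=1..<n. R i j * (v j - v (Suc j))))"
    by (rule sum.cong[OF refl]) (simp only: row)
  also have "\<dots> = (\<Sum>i=1..n. \<Sum>j=1..<n. (v j - v (Suc j)) * (R i j * u i))"
    unfolding sum_distrib_left by (simp add: algebra_simps)
  also have "\<dots> = (\<Sum>j=1..<n. \<Sum>i=1..n. (v j - v (Suc j)) * (R i j * u i))"
    by (rule sum.swap)
  also have "\<dots> = (\<Sum>j=1..<n. \<Sum>i=1..<n. corner D i j * ((u i - u (Suc i)) * (v j - v (Suc j))))"
  proof (rule sum.cong[OF refl])
    fix j assume j: "j \<in> {1..<n}"
    have "(\<Sum>i=1..n. (v j - v (Suc j)) * (R i j * u i)) = (v j - v (Suc j)) * (\<Sum>i=1..n. R i j * u i)"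
      by (simp add: sum_distrib_left)
    also have "\<dots> = (\<Sum>i=1..<n. corner D i j * ((u i - u (Suc i)) * (v j - v (Suc j))))"
      unfolding col[OF j] sum_distrib_left by (simp add: algebra_simps)
    finally show "(\<Sum>i=1..n. (v j - v (Suc j)) * (R i j * u i)) =
      (\<Sum>i=1..<n. corner D i j * ((u i - u (Suc i)) * (v j - v (Suc j))))" .
  qed
  also have "\<dots> = (\<Sum>i=1..<n. \<Sum>j=1..<n. corner D i j * ((u i - u (Suc i)) * (v j - v (Suc j))))"
    by (rule sum.swap)
  finally show ?thesis .
qed

lemma corner_diff: "corner (\<lambda>i j. A i j - B i j) i j = corner A i j - corner B i j"
  by (simp add: corner_def sum_subtractf)

text \<open>
  A rearrangement principle: among matrices with the same line sums, larger corner sums mean a larger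
  bilinear form at nonincreasing sequences.
\<close>
locale corner_dominated =
  fixes n :: nat and A B :: "nat \<Rightarrow> nat \<Rightarrow> real" and u v :: "nat \<Rightarrow> real"
  assumes rows: "\<And>i. i \<in> {1..n} \<Longrightarrow> (\<Sum>j=1..n. A i j) = (\<Sum>j=1..n. B i j)"
    and cols: "\<And>j. j \<in> {1..n} \<Longrightarrow> (\<Sum>i=1..n. A i j) = (\<Sum>i=1..n. B i j)"
    and corner_le: "\<And>i j. i \<in> {1..<n} \<Longrightarrow> j \<in> {1..<n} \<Longrightarrow> corner A i j \<le> corner B i j"
    and u_mono: "\<And>i. i \<in> {1..<n} \<Longrightarrow> u (Suc i) \<le> u i"
    and v_mono: "\<And>j. j \<in> {1..<n} \<Longrightarrow> v (Suc j) \<le> v j"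
begin

lemma bilinear_diff:
  "(\<Sum>i=1..n. \<Sum>j=1..n. B i j * (u i * v j)) - (\<Sum>i=1..n. \<Sum>j=1..n. A i j * (u i * v j)) =
   (\<Sum>i=1..<n. \<Sum>j=1..<n. (corner B i j - corner A i j) * ((u i - u (Suc i)) * (v j - v (Suc j))))"
proof -
  have "(\<Sum>i=1..n. \<Sum>j=1..n. (B i j - A i j) * (u i * v j)) =
    (\<Sum>i=1..<n. \<Sum>j=1..<n. corner (\<lambda>i j. B i j - A i j) i j * ((u i - u (Suc i)) * (v j - v (Suc j))))"
    by (rule double_summation_by_parts) (use rows cols in \<open>simp_all add: sum_subtractf\<close>)
  then show ?thesis by (simp add: corner_diff left_diff_distrib sum_subtractf)
qed

lemma term_nonneg:
  "i \<in> {1..<n} \<Longrightarrow> j \<in> {1..<n} \<Longrightarrow>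
   0 \<le> (corner B i j - corner A i j) * ((u i - u (Suc i)) * (v j - v (Suc j)))"
  using corner_le u_mono v_mono by (intro mult_nonneg_nonneg) (simp_all)

lemma bilinear_le:
  "(\<Sum>i=1..n. \<Sum>j=1..n. A i j * (u i * v j)) \<le> (\<Sum>i=1..n. \<Sum>j=1..n. B i j * (u i * v j))"
proof -
  have "0 \<le> (\<Sum>i=1..<n. \<Sum>j=1..<n. (corner B i j - corner A i j) * ((u i - u (Suc i)) * (v j - v (Suc j))))"
    by (intro sum_nonneg term_nonneg)
  then show ?thesis using bilinear_diff by linarith
qed

lemma bilinear_eqD:
  assumes "(\<Sum>i=1..n. \<Sum>j=1..n. A i j * (u i * v j)) = (\<Sum>i=1..n. \<Sum>j=1..n. B i j * (u i * v j))"
    and i: "i \<in> {1..<n}" "u (Suc i) < u i" and j: "j \<in> {1..<n}" "v (Suc j) < v j"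
  shows "corner A i j = corner B i j"
proof -
  define T where "T i j = (corner B i j - corner A i j) * ((u i - u (Suc i)) * (v j - v (Suc j)))" for i j
  have "(\<Sum>i=1..<n. \<Sum>j=1..<n. T i j) = 0"
    using assms(1) bilinear_diff unfolding T_def by linarith
  moreover have nonneg: "0 \<le> T i j" if "i \<in> {1..<n}" "j \<in> {1..<n}" for i j
    using term_nonneg[OF that] by (simp add: T_def)
  ultimately have "\<forall>i\<in>{1..<n}. (\<Sum>j=1..<n. T i j) = 0"
    by (subst (asm) sum_nonneg_eq_0_iff) (auto intro!: sum_nonneg)
  with i(1) have "(\<Sum>j=1..<n. T i j) = 0" by blast
  then have "\<forall>j\<in>{1..<n}. T i j = 0"
    using nonneg[OF i(1)] by (subst (asm) sum_nonneg_eq_0_iff) auto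
  then have "T i j = 0" using j(1) by blast
  then show ?thesis using i(2) j(2) by (simp add: T_def)
qed

end

section \<open>Corner counts of cubic bipartite graphs\<close>

locale cubic_matrix =
  fixes n :: nat and E :: "nat \<Rightarrow> nat \<Rightarrow> bool"
  assumes row: "\<And>i. i \<in> {1..n} \<Longrightarrow> (\<Sum>j=1..n. of_bool (E i j)) = (3::real)"
    and col: "\<And>j. j \<in> {1..n} \<Longrightarrow> (\<Sum>i=1..n. of_bool (E i j)) = (3::real)"
begin

abbreviation "A \<equiv> \<lambda>i j. of_bool (E i j) :: real"

lemma cubic_matrix_transpose: "cubic_matrix n (\<lambda>i j. E j i)"
  using row col by unfold_locales

lemma partial_row_le: "i \<in> {1..n} \<Longrightarrow> j \<le> n \<Longrightarrow> (\<Sum>l=1..j. A i l) \<le> 3"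
  unfolding row[symmetric] by (rule sum_mono2) auto

lemma corner_le_rows: "i \<le> n \<Longrightarrow> j \<le> n \<Longrightarrow> corner A i j \<le> 3 * real i"
  unfolding corner_def using sum_mono[of "{1..i}" "\<lambda>k. \<Sum>l=1..j. A k l" "\<lambda>_. 3"] partial_row_le
  by simp

lemma corner_full_rows: "i \<le> n \<Longrightarrow> corner A i n = 3 * real i"
proof -
  assume "i \<le> n"
  then have "corner A i n = (\<Sum>k=1..i. 3)"
    unfolding corner_def by (intro sum.cong row) auto
  then show ?thesis by simp
qed

lemma corner_full_cols: "j \<le> n \<Longrightarrow> corner A n j = 3 * real j"
  using cubic_matrix.corner_full_rows[OF cubic_matrix_transpose, of j] corner_transpose[of A j n]
  by simp

lemma corner_le_area: "corner A i j \<le> real i * real j"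
proof -
  have "corner A i j \<le> (\<Sum>k=1..i. \<Sum>l=1..j. 1)"
    unfolding corner_def by (intro sum_mono) auto
  then show ?thesis by simp
qed

text \<open>
  If the first \<open>i\<close> rows have all their entries within the first \<open>j\<close> columns, nothing is left outside.
  For \<open>i = j\<close> this is the situation that connectedness excludes.
\<close>
lemma corner_eq_rowsD:
  assumes eq: "corner A i j = 3 * real i" and ij: "i \<le> n" "j \<le> n" and kl: "k \<in> {1..i}" "l \<in> {Suc j..n}"
  shows "\<not> E k l"
proof
  assume "E k l"
  have lt: "(\<Sum>l=1..j. A k l) < (\<Sum>l=1..n. A k l)"
    by (rule sum_strict_mono2[of _ _ l]) (use ij kl \<open>E k l\<close> in auto)
  have "corner A i j < (\<Sum>k=1..i. 3)"
    unfolding corner_def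
  proof (rule sum_strict_mono_ex1)
    show "\<forall>k\<in>{1..i}. (\<Sum>l=1..j. A k l) \<le> 3" using partial_row_le ij by auto
    show "\<exists>k\<in>{1..i}. (\<Sum>l=1..j. A k l) < 3" using lt row[of k] kl ij by (intro bexI[of _ k]) auto
  qed simp
  then show False using eq by simp
qed

text \<open>
  The line sums turn a bound for the complementary bottom right corner, which has area
  \<open>(n - i) (n - j)\<close>, into one for the top left corner.
\<close>
lemma corner_le_opposite:
  assumes "i \<le> n" "j \<le> n"
  shows "corner A i j \<le> 3 * real i + 3 * real j - 3 * real n + (real n - real i) * (real n - real j)"
proof -
  have split: "(\<Sum>k=1..n. g k) = (\<Sum>k=1..m. g k) + (\<Sum>k=Suc m..n. g k)" if "m \<le> n" for m and g :: "nat \<Rightarrow> real"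
    using sum.ub_add_nat[of 1 m g "n - m"] that by simp
  have "corner A i j + (\<Sum>k=1..i. \<Sum>l=Suc j..n. A k l) = (\<Sum>k=1..i. \<Sum>l=1..n. A k l)"
    unfolding corner_def sum.distrib[symmetric] split[OF assms(2)] ..
  also have "\<dots> = (\<Sum>k=1..i. 3)" using assms by (intro sum.cong row) auto
  finally have 1: "corner A i j + (\<Sum>k=1..i. \<Sum>l=Suc j..n. A k l) = 3 * real i" by simp
  have "(\<Sum>k=1..i. \<Sum>l=Suc j..n. A k l) + (\<Sum>k=Suc i..n. \<Sum>l=Suc j..n. A k l)
      = (\<Sum>l=Suc j..n. \<Sum>k=1..n. A k l)"
    unfolding split[OF assms(1), symmetric] by (rule sum.swap)
  also have "\<dots> = (\<Sum>l=Suc j..n. 3)" by (intro sum.cong col) auto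
  finally have 2: "(\<Sum>k=1..i. \<Sum>l=Suc j..n. A k l) + (\<Sum>k=Suc i..n. \<Sum>l=Suc j..n. A k l)
    = 3 * (real n - real j)" using assms by (simp add: of_nat_diff)
  have "(\<Sum>k=Suc i..n. \<Sum>l=Suc j..n. A k l) \<le> (\<Sum>k=Suc i..n. \<Sum>l=Suc j..n. 1)"
    by (intro sum_mono) auto
  also have "\<dots> = (real n - real i) * (real n - real j)" using assms by (simp add: of_nat_diff)
  finally show ?thesis using 1 2 by (simp add: algebra_simps)
qed

end

section \<open>The corner counts of \<open>H\<^sub>2\<^sub>n\<close> are extremal\<close>

lemma H_edge_commute: "H_edge n i j \<longleftrightarrow> H_edge n j i"
  unfolding H_edge_def by auto

lemma H_nbrs:
  fixes n i j :: nat
  assumes n: "n \<ge> 6"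
  shows "i \<in> {1, 2} \<Longrightarrow> H_edge n i j \<longleftrightarrow> j = 1 \<or> j = 2 \<or> j = 3"
    and "H_edge n 3 j \<longleftrightarrow> j = 1 \<or> j = 2 \<or> j = 4"
    and "4 \<le> i \<Longrightarrow> i \<le> n - 3 \<Longrightarrow> H_edge n i j \<longleftrightarrow> j = i - 1 \<or> j = i \<or> j = i + 1"
    and "H_edge n (n - 2) j \<longleftrightarrow> j = n - 3 \<or> j = n - 1 \<or> j = n"
    and "i \<in> {n - 1, n} \<Longrightarrow> H_edge n i j \<longleftrightarrow> j = n - 2 \<or> j = n - 1 \<or> j = n"
proof -
  obtain m where m: "n = m + 6" using n le_Suc_ex by (metis add.commute)
  have s: "m + 6 - 3 = m + 3" "m + 6 - 2 = m + 4" "m + 6 - 1 = m + 5" by simp_all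
  show "H_edge n i j \<longleftrightarrow> j = 1 \<or> j = 2 \<or> j = 3" if i: "i \<in> {1, 2}"
  proof -
    have "i \<in> {1, 2, 3}" "i \<noteq> 3" "i \<notin> {m + 4, m + 5, m + 6}" "i \<noteq> j + 1 \<or> \<not> 3 \<le> j" "\<not> 3 \<le> i" "\<not> 4 \<le> i"
      using i by auto
    then show ?thesis unfolding H_edge_def m s by blast
  qed
  show "H_edge n 3 j \<longleftrightarrow> j = 1 \<or> j = 2 \<or> j = 4"
    unfolding H_edge_def m s by auto
  show "H_edge n i j \<longleftrightarrow> j = i - 1 \<or> j = i \<or> j = i + 1" if i: "4 \<le> i" "i \<le> n - 3"
  proof -
    have i': "i \<le> m + 3" using i(2) unfolding m s .
    then have "i \<notin> {1, 2, 3}" "i \<notin> {m + 4, m + 5, m + 6}" "3 \<le> i" using i(1) by auto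
    then have "H_edge n i j \<longleftrightarrow> j = i + 1 \<or> 3 \<le> j \<and> j \<le> m + 3 \<and> i = j + 1 \<or> j = i"
      unfolding H_edge_def m s using i(1) i' by blast
    moreover have "3 \<le> j \<and> j \<le> m + 3 \<and> i = j + 1 \<longleftrightarrow> j = i - 1" using i(1) i' by linarith
    ultimately show ?thesis by blast
  qed
  show "H_edge n (n - 2) j \<longleftrightarrow> j = n - 3 \<or> j = n - 1 \<or> j = n"
  proof -
    have "3 \<le> j \<and> j \<le> m + 3 \<and> m + 4 = j + 1 \<longleftrightarrow> j = m + 3" by auto
    then show ?thesis unfolding H_edge_def m s by auto
  qed
  show "H_edge n i j \<longleftrightarrow> j = n - 2 \<or> j = n - 1 \<or> j = n" if i: "i \<in> {n - 1, n}"
  proof -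
    have "i = m + 5 \<or> i = m + 6" using i unfolding m s by blast
    then have "i \<notin> {1, 2, 3}" "\<not> i \<le> m + 3" "i \<in> {m + 4, m + 5, m + 6}" "i \<noteq> m + 4"
      "\<not> (j \<le> m + 3 \<and> i = j + 1)" by auto
    then show ?thesis unfolding H_edge_def m s by blast
  qed
qed

text \<open>
  In the middle part, the two vertex pairs \<open>{u\<^sub>i, v\<^sub>i}\<close> and \<open>{u\<^sub>i\<^sub>+\<^sub>1, v\<^sub>i\<^sub>+\<^sub>1}\<close> are joined by the only edges
  that pass the cut after index \<open>i\<close>.
\<close>
lemma H_edge_beyond:
  assumes "3 \<le> i" "i \<le> n - 3" "k \<le> i" "i < j"
  shows "H_edge n k j \<longleftrightarrow> k = i \<and> j = Suc i"
proof -
  have "j \<notin> {1,2,3}" "k \<notin> {n - 2, n - 1, n}" "k \<noteq> j + 1" "j \<noteq> k" "3 \<le> k \<and> k \<le> n - 3 \<and> j = k + 1 \<longleftrightarrow> k = i \<and> j = Suc i"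
    using assms by auto
  then show ?thesis unfolding H_edge_def by blast
qed

lemma index_cases:
  fixes n i :: nat
  assumes "n \<ge> 6" "i \<in> {1..n}"
  obtains "i \<in> {1, 2}" | "i = 3" | "4 \<le> i" "i \<le> n - 3" | "i = n - 2" | "i \<in> {n - 1, n}"
proof -
  consider "i < 3" | "i = 3" | "4 \<le> i" "i \<le> n - 3" | "n - 3 < i" by linarith
  then show thesis
  proof cases
    case 1
    then have "i = 1 \<or> i = 2" using assms(2) by auto
    then show thesis using that(1) by blast
  next
    case 4
    then have "i = n - 2 \<or> i = n - 1 \<or> i = n" using assms by auto
    then show thesis using that(4,5) by blast
  qed (use that in blast)+
qed

lemma corner_cases:
  fixes i j n :: nat
  assumes "n \<ge> 6" "i \<le> j" "1 \<le> i" "j < n"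
  shows "i = 1 \<or> i = 2 \<and> j = 2 \<or> 2 \<le> i \<and> i \<le> n - 3 \<and> i < j \<or> 3 \<le> i \<and> i \<le> n - 3 \<and> j = i \<or>
    i = n - 2 \<and> j = n - 2 \<or> i = n - 2 \<and> j = n - 1 \<or> i = n - 1 \<and> j = n - 1"
proof -
  consider "i = 1" | "2 \<le> i" "i < j" "i \<le> n - 3" | "2 \<le> i" "i = j" "i \<le> n - 3" | "n - 3 < i" using assms by linarith
  then show ?thesis
  proof cases
    case 3
    then have "i = 2 \<or> 3 \<le> i" by linarith
    then show ?thesis using 3 by blast
  next
    case 4
    then have "i = n - 2 \<or> i = n - 1" using assms by auto
    moreover have "i = n - 2 \<Longrightarrow> j = n - 2 \<or> j = n - 1" "i = n - 1 \<Longrightarrow> j = n - 1" using assms by auto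
    ultimately show ?thesis by blast
  qed blast+
qed

lemma sum_H_edge:
  fixes g :: "nat \<Rightarrow> real"
  assumes n: "n \<ge> 6"
  shows "i \<in> {1, 2} \<Longrightarrow> (\<Sum>j=1..n. of_bool (H_edge n i j) * g j) = g 1 + g 2 + g 3"
    and "(\<Sum>j=1..n. of_bool (H_edge n 3 j) * g j) = g 1 + g 2 + g 4"
    and "4 \<le> i \<Longrightarrow> i \<le> n - 3 \<Longrightarrow> (\<Sum>j=1..n. of_bool (H_edge n i j) * g j) = g (i - 1) + g i + g (i + 1)"
    and "(\<Sum>j=1..n. of_bool (H_edge n (n - 2) j) * g j) = g (n - 3) + g (n - 1) + g n"
    and "i \<in> {n - 1, n} \<Longrightarrow> (\<Sum>j=1..n. of_bool (H_edge n i j) * g j) = g (n - 2) + g (n - 1) + g n"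
proof -
  have *: "(\<Sum>j=1..n. of_bool (H_edge n i j) * g j) = g a + g b + g c"
    if "\<And>j. H_edge n i j \<longleftrightarrow> j = a \<or> j = b \<or> j = c" "1 \<le> a" "a < b" "b < c" "c \<le> n" for i a b c
  proof -
    have "(\<Sum>j=1..n. of_bool (H_edge n i j) * g j) = (\<Sum>j\<in>{a, b, c}. of_bool (H_edge n i j) * g j)"
      using that by (intro sum.mono_neutral_right) auto
    also have "\<dots> = g a + g b + g c" using that by (simp add: add.assoc)
    finally show ?thesis .
  qed
  show "(\<Sum>j=1..n. of_bool (H_edge n i j) * g j) = g 1 + g 2 + g 3" if "i \<in> {1, 2}"
    using * [OF H_nbrs(1)[OF n that]] n by simp
  show "(\<Sum>j=1..n. of_bool (H_edge n 3 j) * g j) = g 1 + g 2 + g 4"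
    using * [OF H_nbrs(2)[OF n]] n by simp
  show "(\<Sum>j=1..n. of_bool (H_edge n i j) * g j) = g (i - 1) + g i + g (i + 1)" if "4 \<le> i" "i \<le> n - 3"
    by (rule * [OF H_nbrs(3)[OF n that]]) (use that n in linarith)+
  show "(\<Sum>j=1..n. of_bool (H_edge n (n - 2) j) * g j) = g (n - 3) + g (n - 1) + g n"
    by (rule * [OF H_nbrs(4)[OF n]]) (use n in linarith)+
  show "(\<Sum>j=1..n. of_bool (H_edge n i j) * g j) = g (n - 2) + g (n - 1) + g n" if "i \<in> {n - 1, n}"
    by (rule * [OF H_nbrs(5)[OF n that]]) (use n in linarith)+
qed

lemma cubic_matrix_H:
  assumes n: "n \<ge> 6"
  shows "cubic_matrix n (H_edge n)"
proof -
  have row: "(\<Sum>j=1..n. of_bool (H_edge n i j)) = (3::real)" if "i \<in> {1..n}" for i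
  proof -
    have "(\<Sum>j=1..n. of_bool (H_edge n i j) * (1::real)) = 1 + 1 + 1"
      by (rule index_cases[OF n that]) (simp_all only: sum_H_edge[OF n, where g = "\<lambda>_. 1"])
    then show ?thesis by simp
  qed
  moreover have "(\<Sum>i=1..n. of_bool (H_edge n i j)) = (3::real)" if "j \<in> {1..n}" for j
    using row[OF that] unfolding H_edge_commute[of n _ j] .
  ultimately show ?thesis by unfold_locales
qed

lemma partial_row_H:
  assumes n: "n \<ge> 6" and j: "j \<le> n"
  shows "(\<Sum>l=1..j. of_bool (H_edge n i l)) = (\<Sum>l=1..n. of_bool (H_edge n i l) * (of_bool (l \<le> j) :: real))"
proof -
  have "(\<Sum>l=1..n. of_bool (H_edge n i l) * (of_bool (l \<le> j) :: real)) = (\<Sum>l=1..j. of_bool (H_edge n i l) * (of_bool (l \<le> j)))"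
    using j by (intro sum.mono_neutral_right) auto
  then show ?thesis by simp
qed

lemma full_rows_H:
  assumes n: "n \<ge> 6" and k: "k \<in> {1..n}" "k \<le> n - 3" "k + 1 \<le> j" "3 \<le> j" "j \<le> n"
  shows "(\<Sum>l=1..j. of_bool (H_edge n k l)) = (3::real)"
  unfolding partial_row_H[OF n k(5)]
proof (cases rule: index_cases[OF n k(1)])
  case 1
  then show "(\<Sum>l=1..n. of_bool (H_edge n k l) * of_bool (l \<le> j)) = (3::real)"
    by (subst sum_H_edge(1)[OF n]) (use k in auto)
next
  case 2
  show "(\<Sum>l=1..n. of_bool (H_edge n k l) * of_bool (l \<le> j)) = (3::real)"
    unfolding 2 by (subst sum_H_edge(2)[OF n]) (use k 2 in auto)
next
  case 3
  then show "(\<Sum>l=1..n. of_bool (H_edge n k l) * of_bool (l \<le> j)) = (3::real)"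
    by (subst sum_H_edge(3)[OF n]) (use k in auto)
qed (use n k(2) in auto)

lemma corner_H_rows:
  assumes n: "n \<ge> 6" and i: "i \<le> n - 3" "i + 1 \<le> j" "3 \<le> j" "j \<le> n"
  shows "corner (\<lambda>i j. of_bool (H_edge n i j)) i j = 3 * real i"
proof -
  have "corner (\<lambda>i j. of_bool (H_edge n i j)) i j = (\<Sum>k=1..i. 3)"
    unfolding corner_def using n i by (intro sum.cong full_rows_H) auto
  then show ?thesis by simp
qed

lemma corner_Suc: "corner A (Suc i) j = corner A i j + (\<Sum>l=1..j. A (Suc i) l)"
  by (simp add: corner_def)

text \<open>
  In each case the corner count of \<open>H\<^sub>2\<^sub>n\<close> equals one of the upper bounds: the area bound at the
  upper left end, \<open>3i\<close> above the diagonal, \<open>3i - 1\<close> on the diagonal, and the bound by the opposite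
  corner at the lower right end.
\<close>
lemma (in cubic_matrix) corner_le_corner_H_above_diagonal:
  assumes n: "n \<ge> 6" and cut: "\<And>i. i \<in> {1..<n} \<Longrightarrow> corner A i i \<noteq> 3 * real i"
    and ij: "i \<le> j" "i \<in> {1..<n}" "j \<in> {1..<n}"
  shows "corner A i j \<le> corner (\<lambda>i j. of_bool (H_edge n i j)) i j"
proof -
  let ?H = "\<lambda>i j. of_bool (H_edge n i j) :: real"
  have Suc': "corner ?H i j = corner ?H (i - 1) j + (\<Sum>l=1..n. ?H i l * of_bool (l \<le> j))"
    if "i \<ge> 1" "j \<le> n" for i j
    using corner_Suc[of ?H "i - 1" j] that partial_row_H[OF n that(2), of i] by simp
  have r2: "corner ?H (n - 2) j = 3 * real n - 9 + (of_bool (n - 3 \<le> j) + of_bool (n - 1 \<le> j) + of_bool (n \<le> j))"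
    if "n - 2 \<le> j" "j \<le> n" for j
  proof -
    have "corner ?H (n - 2) j = corner ?H (n - 2 - 1) j + (\<Sum>l=1..n. ?H (n - 2) l * of_bool (l \<le> j))"
      by (rule Suc') (use n that in auto)
    also have "n - 2 - 1 = n - 3" by simp
    also have "corner ?H (n - 3) j = 3 * real (n - 3)" by (rule corner_H_rows[OF n]) (use n that in auto)
    also have "(\<Sum>l=1..n. ?H (n - 2) l * of_bool (l \<le> j)) = of_bool (n - 3 \<le> j) + of_bool (n - 1 \<le> j) + of_bool (n \<le> j)"
      by (rule sum_H_edge(4)[OF n])
    finally show ?thesis using n by (simp add: of_nat_diff)
  qed
  have rows: "corner A i j \<le> 3 * real i" by (rule corner_le_rows) (use ij in auto)
  have cut': "corner A i i \<le> 3 * real i - 1"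
  proof -
    have "corner A i i = of_int (\<Sum>k=1..i. \<Sum>l=1..i. of_bool (E k l))"
      by (simp add: corner_def)
    then obtain z :: int where z: "corner A i i = of_int z" by blast
    have "corner A i i \<le> 3 * real i" by (rule corner_le_rows) (use ij in auto)
    then have "corner A i i < 3 * real i" using cut[OF ij(2)] by simp
    then have "z < 3 * int i" unfolding z by linarith
    then have "z \<le> 3 * int i - 1" by simp
    then show ?thesis unfolding z by linarith
  qed
  have opp: "corner A i j \<le> 3 * real i + 3 * real j - 3 * real n + (real n - real i) * (real n - real j)"
    by (rule corner_le_opposite) (use ij in auto)
  have "i = 1 \<or> i = 2 \<and> j = 2 \<or> 2 \<le> i \<and> i \<le> n - 3 \<and> i < j \<or> 3 \<le> i \<and> i \<le> n - 3 \<and> j = i \<or>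
    i = n - 2 \<and> j = n - 2 \<or> i = n - 2 \<and> j = n - 1 \<or> i = n - 1 \<and> j = n - 1"
    using corner_cases[OF n ij(1)] ij by simp
  then consider (one) "i = 1" | (two) "i = 2" "j = 2" | (full) "2 \<le> i" "i \<le> n - 3" "i < j"
    | (diag) "3 \<le> i" "i \<le> n - 3" "j = i" | (c1) "i = n - 2" "j = n - 2" | (c2) "i = n - 2" "j = n - 1"
    | (c3) "i = n - 1" "j = n - 1"
    by blast
  then show ?thesis
  proof cases
    case one
    have "corner A i j \<le> real j" using corner_le_area[of i j] one by simp
    moreover have "corner ?H i j = of_bool (1 \<le> j) + of_bool (2 \<le> j) + of_bool (3 \<le> j)"
      using Suc'[of i j] sum_H_edge(1)[OF n, of i "\<lambda>l. of_bool (l \<le> j)"] one ij by (simp add: corner_def)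
    ultimately show ?thesis using rows one ij by auto
  next
    case two
    have "corner ?H 2 2 = 4"
      using Suc'[of 2 2] Suc'[of 1 2] sum_H_edge(1)[OF n, of _ "\<lambda>l. of_bool (l \<le> 2)"] n
      by (simp add: corner_def)
    then show ?thesis using corner_le_area[of i j] two by simp
  next
    case full
    then show ?thesis using corner_H_rows[OF n, of i j] rows ij by simp
  next
    case diag
    have "corner ?H i i = 3 * real (i - 1) + (\<Sum>l=1..n. ?H i l * of_bool (l \<le> i))"
      using Suc'[of i i] corner_H_rows[OF n, of "i - 1" i] diag by simp
    also have "(\<Sum>l=1..n. ?H i l * of_bool (l \<le> i)) = 2"
      using sum_H_edge(2)[OF n, of "\<lambda>l. of_bool (l \<le> i)"] sum_H_edge(3)[OF n, of i "\<lambda>l. of_bool (l \<le> i)"] diag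
      by (cases "i = 3") auto
    finally show ?thesis using cut' diag by (simp add: of_nat_diff)
  next
    case c1
    have "n - 3 \<le> n - 2" "\<not> n - 1 \<le> n - 2" "\<not> n \<le> n - 2" using n by auto
    then have "corner ?H i j = 3 * real n - 8"
      using r2[of j] c1 n by simp
    then show ?thesis using opp c1 n by (simp add: of_nat_diff)
  next
    case c2
    have "n - 2 \<le> n - 1" "n - 3 \<le> n - 1" "\<not> n \<le> n - 1" using n by auto
    then have "corner ?H i j = 3 * real n - 7"
      using r2[of j] c2 n by simp
    then show ?thesis using opp c2 n by (simp add: of_nat_diff)
  next
    case c3
    have le: "n - 2 \<le> n - 1" "n - 3 \<le> n - 1" "\<not> n \<le> n - 1" using n by auto
    have "corner ?H (n - 1) (n - 1) = corner ?H (n - 1 - 1) (n - 1) + (\<Sum>l=1..n. ?H (n - 1) l * of_bool (l \<le> n - 1))"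
      by (rule Suc') (use n in auto)
    also have "n - 1 - 1 = n - 2" by simp
    also have "(\<Sum>l=1..n. ?H (n - 1) l * of_bool (l \<le> n - 1)) =
        of_bool (n - 2 \<le> n - 1) + of_bool (n - 1 \<le> n - 1) + of_bool (n \<le> n - 1)"
      by (rule sum_H_edge(5)[OF n]) simp
    finally have "corner ?H i j = 3 * real n - 5"
      using r2[of "n - 1"] le c3 n by simp
    then show ?thesis using opp c3 n by (simp add: of_nat_diff)
  qed
qed

lemma (in cubic_matrix) corner_le_corner_H:
  assumes n: "n \<ge> 6" and cut: "\<And>i. i \<in> {1..<n} \<Longrightarrow> corner A i i \<noteq> 3 * real i"
    and ij: "i \<in> {1..<n}" "j \<in> {1..<n}"
  shows "corner A i j \<le> corner (\<lambda>i j. of_bool (H_edge n i j)) i j"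
proof (cases "i \<le> j")
  case True
  then show ?thesis using corner_le_corner_H_above_diagonal[OF n cut] ij by blast
next
  case False
  interpret T: cubic_matrix n "\<lambda>i j. E j i" by (rule cubic_matrix_transpose)
  have "corner T.A j i \<le> corner (\<lambda>i j. of_bool (H_edge n i j)) j i"
    by (rule T.corner_le_corner_H_above_diagonal[OF n]) (use False ij cut corner_transpose[of A] in auto)
  also have "\<dots> = corner (\<lambda>i j. of_bool (H_edge n i j)) i j"
    using corner_transpose[of "\<lambda>i j. of_bool (H_edge n i j)" i j] H_edge_commute[of n] by simp
  finally show ?thesis using corner_transpose[of A j i] by simp
qed

lemma corner_rect:
  assumes "i' \<le> i" "j' \<le> j"
  shows "(\<Sum>k=Suc i'..i. \<Sum>l=Suc j'..j. A k l) = corner A i j - corner A i' j - corner A i j' + corner A i' j'"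
proof -
  have split: "(\<Sum>k=Suc m'..m. g k) = (\<Sum>k=1..m. g k) - (\<Sum>k=1..m'. g k)" if "m' \<le> m" for m m' and g :: "nat \<Rightarrow> real"
    using sum.ub_add_nat[of 1 m' g "m - m'"] that by simp
  show ?thesis
    unfolding split[OF assms(1)] split[OF assms(2)] corner_def by (simp add: sum_subtractf)
qed

text \<open>
  The first two indices are twins in \<open>H\<^sub>2\<^sub>n\<close>, and so are the last two.  The known corners (together with
  those at \<open>0\<close> and \<open>n\<close>, which are fixed by the line sums) give the number of edges of each block formed
  by twin pairs and single indices.  As \<open>H\<^sub>2\<^sub>n\<close> fills each block completely or not at all, these numbers
  leave no choice.
\<close>
lemma (in cubic_matrix) eq_H_if_corners_eq:
  assumes n: "n \<ge> 6"
    and eq: "\<And>i j. i \<in> {2..n-2} \<Longrightarrow> j \<in> {2..n-2} \<Longrightarrow> corner A i j = corner (\<lambda>i j. of_bool (H_edge n i j)) i j"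
    and ij: "i \<in> {1..n}" "j \<in> {1..n}"
  shows "E i j \<longleftrightarrow> H_edge n i j"
proof -
  let ?H = "\<lambda>i j. of_bool (H_edge n i j) :: real"
  interpret H: cubic_matrix n "H_edge n" by (rule cubic_matrix_H[OF n])
  have rows: "corner A i n = corner ?H i n" if "i \<le> n" for i
    using that by (simp only: corner_full_rows H.corner_full_rows)
  have cols: "corner A n j = corner ?H n j" if "j \<le> n" for j
    using that by (simp only: corner_full_cols H.corner_full_cols)
  define good where "good = insert 0 (insert n {2..n-2})"
  have good: "corner A i j = corner ?H i j" if ij': "i \<in> good" "j \<in> good" for i j
  proof -
    consider "i = 0 \<or> j = 0" | "i = n" "j \<le> n" | "j = n" "i \<le> n" | "i \<in> {2..n-2}" "j \<in> {2..n-2}"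
      using ij' n unfolding good_def by force
    then show ?thesis
      by cases (use rows cols eq in \<open>auto simp only: corner_def atLeastatMost_empty' sum.empty sum.neutral_const\<close>)
  qed
  \<comment> \<open>The block of \<open>k\<close> consists of the indices from \<open>lo k + 1\<close> to \<open>hi k\<close>.\<close>
  define lo where "lo k = (if k \<le> 2 then 0 else if n - 1 \<le> k then n - 2 else k - 1)" for k
  define hi where "hi k = (if k \<le> 2 then 2 else if n - 1 \<le> k then n else k)" for k
  have lohi: "lo k \<in> good" "hi k \<in> good" "lo k \<le> hi k" "k \<in> {Suc (lo k)..hi k}" if "k \<in> {1..n}" for k
    using that n by (auto simp: lo_def hi_def good_def)
  have twin: "H_edge n k' l \<longleftrightarrow> H_edge n k l" if "k \<in> {1..n}" "k' \<in> {Suc (lo k)..hi k}" for k k' l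
  proof -
    consider "k \<le> 2" | "n - 1 \<le> k" | "2 < k" "k < n - 1" by linarith
    then show ?thesis
    proof cases
      case 1
      then have "k \<in> {1, 2}" "k' \<in> {1, 2}" using that by (auto simp: lo_def hi_def)
      then show ?thesis by (simp only: H_nbrs(1)[OF n])
    next
      case 2
      then have "\<not> k \<le> 2" using n by linarith
      then have "k \<in> {n - 1, n}" "k' \<in> {n - 1, n}" using 2 that by (auto simp: lo_def hi_def)
      then show ?thesis by (simp only: H_nbrs(5)[OF n])
    next
      case 3
      then have "k' = k" using that by (auto simp: lo_def hi_def)
      then show ?thesis by simp
    qed
  qed
  define R where "R = {Suc (lo i)..hi i} \<times> {Suc (lo j)..hi j}"
  have ijR: "(i, j) \<in> R" and "finite R" using lohi(4) ij by (auto simp: R_def)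
  have const: "H_edge n k l \<longleftrightarrow> H_edge n i j" if "(k, l) \<in> R" for k l
    using that twin[of i k l] twin[of j l i] ij H_edge_commute[of n i] by (auto simp: R_def)
  have rect: "(\<Sum>(k,l)\<in>R. M k l) = corner M (hi i) (hi j) - corner M (lo i) (hi j)
      - corner M (hi i) (lo j) + corner M (lo i) (lo j)" for M
    unfolding R_def sum.cartesian_product[symmetric]
    by (rule corner_rect[OF lohi(3)[OF ij(1)] lohi(3)[OF ij(2)]])
  have "(\<Sum>(k,l)\<in>R. A k l) = (\<Sum>(k,l)\<in>R. ?H k l)"
    using good lohi(1,2) ij by (simp only: rect)
  also have "\<dots> = (\<Sum>(k,l)\<in>R. ?H i j)" using const by (intro sum.cong) auto
  finally have sums: "(\<Sum>(k,l)\<in>R. A k l - ?H i j) = 0" by (simp add: case_prod_unfold sum_subtractf)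
  show ?thesis
  proof (cases "H_edge n i j")
    case True
    then have "(\<Sum>(k,l)\<in>R. 1 - A k l) = 0" using sums by (simp add: case_prod_unfold sum_subtractf)
    then have "1 - A i j = 0" 
      using ijR \<open>finite R\<close> by (subst (asm) sum_nonneg_eq_0_iff) auto
    then show ?thesis using True by auto
  next
    case False
    then have "(\<Sum>(k,l)\<in>R. A k l) = 0" using sums by simp
    then have "A i j = 0" 
      using ijR \<open>finite R\<close> by (subst (asm) sum_nonneg_eq_0_iff) auto
    then show ?thesis using False by auto
  qed
qed

section \<open>Monotone eigenvectors of \<open>H\<^sub>2\<^sub>n\<close>\<close>

lemma partial_sum_pos:
  fixes w :: "nat \<Rightarrow> real"
  assumes anti: "\<And>i j. 1 \<le> i \<Longrightarrow> i \<le> j \<Longrightarrow> j \<le> n \<Longrightarrow> w j \<le> w i"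
    and sum0: "(\<Sum>k=1..n. w k) = 0" and i: "i \<in> {1..<n}" and nz: "k0 \<in> {1..n}" "w k0 \<noteq> 0"
  shows "(\<Sum>k=1..i. w k) > 0"
proof (rule ccontr)
  assume "\<not> ?thesis"
  then have le: "(\<Sum>k=1..i. w k) \<le> 0" by simp
  have split: "(\<Sum>k=1..i. w k) + (\<Sum>k=Suc i..n. w k) = 0"
    using sum.ub_add_nat[of 1 i w "n - i"] i sum0 by simp
  have "w i \<le> 0"
  proof (rule ccontr)
    assume "\<not> w i \<le> 0"
    then have "0 < w k" if "k \<in> {1..i}" for k using anti[of k i] that i by force
    then have "(\<Sum>k=1..i. w k) > 0" using i by (intro sum_pos) auto
    then show False using le by simp
  qed
  then have neg: "w k \<le> 0" if "k \<in> {Suc i..n}" for k using anti[of i k] that i by force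
  then have "(\<Sum>k=Suc i..n. w k) \<le> 0" by (rule sum_nonpos)
  then have zero: "(\<Sum>k=1..i. w k) = 0" "(\<Sum>k=Suc i..n. w k) = 0" using split le by auto
  have tail: "w k = 0" if "k \<in> {Suc i..n}" for k
  proof -
    have "(\<Sum>k=Suc i..n. - w k) = 0" using zero(2) by (simp add: sum_negf)
    then show ?thesis using neg that by (subst (asm) sum_nonneg_eq_0_iff) auto
  qed
  have "w n = 0" using tail[of n] i by simp
  then have pos: "0 \<le> w k" if "k \<in> {1..i}" for k using anti[of k n] that i by force
  have head: "w k = 0" if "k \<in> {1..i}" for k
    using zero(1) pos that by (subst (asm) sum_nonneg_eq_0_iff) auto
  show False using nz head[of k0] tail[of k0] by force
qed

text \<open>
  An eigenvector of \<open>H\<^sub>2\<^sub>n\<close> that is nonincreasing on both colour classes.  The bound \<open>\<rho> < 6\<close> excludes the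
  eigenvector which is \<open>1\<close> on one class and \<open>-1\<close> on the other, with eigenvalue \<open>6\<close>.
\<close>
locale H_eigenpair =
  fixes n :: nat and u v :: "nat \<Rightarrow> real" and \<rho> :: real
  assumes n: "n \<ge> 6"
    and u_anti: "\<And>i j. 1 \<le> i \<Longrightarrow> i \<le> j \<Longrightarrow> j \<le> n \<Longrightarrow> u j \<le> u i"
    and v_anti: "\<And>i j. 1 \<le> i \<Longrightarrow> i \<le> j \<Longrightarrow> j \<le> n \<Longrightarrow> v j \<le> v i"
    and u_eig: "\<And>i. i \<in> {1..n} \<Longrightarrow> (\<Sum>j=1..n. of_bool (H_edge n i j) * (u i - v j)) = \<rho> * u i"
    and v_eig: "\<And>i. i \<in> {1..n} \<Longrightarrow> (\<Sum>j=1..n. of_bool (H_edge n i j) * (v i - u j)) = \<rho> * v i"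
    and sum0: "(\<Sum>k=1..n. u k + v k) = 0"
    and rho: "\<rho> > 0" "\<rho> < 6"
    and nontrivial: "\<exists>i\<in>{1..n}. u i \<noteq> 0 \<or> v i \<noteq> 0"
begin

lemma swapped: "H_eigenpair n v u \<rho>"
  using n u_anti v_anti u_eig v_eig sum0 rho nontrivial
  by unfold_locales (auto simp: add.commute)

text \<open>
  The sums over the pairs \<open>{u\<^sub>k, v\<^sub>k}\<close> satisfy the eigenvalue equation of a single symmetric matrix,
  because \<open>H\<^sub>2\<^sub>n\<close> is invariant under exchanging the two classes.
\<close>
definition "w k = u k + v k"

lemma w_anti: "1 \<le> i \<Longrightarrow> i \<le> j \<Longrightarrow> j \<le> n \<Longrightarrow> w j \<le> w i"
  unfolding w_def using u_anti v_anti by (intro add_mono)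

lemma w_nontrivial: "\<exists>k\<in>{1..n}. w k \<noteq> 0"
proof (rule ccontr)
  assume "\<not> ?thesis"
  then have vu: "v k = - u k" if "k \<in> {1..n}" for k using that unfolding w_def by force
  have const: "u k = u 1" if "k \<in> {1..n}" for k
    using u_anti[of 1 k] v_anti[of 1 k] vu[of k] vu[of 1] that n by force
  have "(\<Sum>j=1..n. of_bool (H_edge n 1 j) * (u 1 - v j)) = (\<Sum>j=1..n. of_bool (H_edge n 1 j) * (2 * u 1))"
  proof (rule sum.cong[OF refl])
    fix j assume "j \<in> {1..n}"
    then show "of_bool (H_edge n 1 j) * (u 1 - v j) = of_bool (H_edge n 1 j) * (2 * u 1)"
      using vu[of j] const[of j] by simp
  qed
  also have "\<dots> = 6 * u 1" using sum_H_edge(1)[OF n, of 1 "\<lambda>_. 2 * u 1"] by simp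
  finally have "(\<rho> - 6) * u 1 = 0" using u_eig[of 1] n by (simp add: algebra_simps)
  then have "u 1 = 0" using rho by simp
  moreover obtain i where "i \<in> {1..n}" "u i \<noteq> 0 \<or> v i \<noteq> 0" using nontrivial by blast
  ultimately show False using const[of i] vu[of i] by simp
qed

text \<open>
  Summing the eigenvalue equation over the first \<open>i\<close> pairs leaves only the flow through the cut after
  them, that is \<open>w i - w (i + 1)\<close>.  It equals \<open>\<rho>\<close> times a partial sum of a nonincreasing nonzero sequence
  with total sum zero, which is positive.
\<close>
lemma w_strict:
  assumes i: "3 \<le> i" "i \<le> n - 3"
  shows "w (Suc i) < w i"
proof -
  let ?H = "\<lambda>i j. of_bool (H_edge n i j) :: real"
  have split: "(\<Sum>j=1..n. g j) = (\<Sum>j=1..i. g j) + (\<Sum>j=Suc i..n. g j)" for g :: "nat \<Rightarrow> real"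
    using sum.ub_add_nat[of 1 i g "n - i"] i by simp
  have "\<rho> * (\<Sum>k=1..i. w k) = (\<Sum>k=1..i. \<Sum>j=1..n. ?H k j * (w k - w j))"
    unfolding sum_distrib_left
  proof (rule sum.cong[OF refl])
    fix k assume "k \<in> {1..i}"
    then have k: "k \<in> {1..n}" using i by auto
    have "\<rho> * w k = (\<Sum>j=1..n. ?H k j * (u k - v j)) + (\<Sum>j=1..n. ?H k j * (v k - u j))"
      using u_eig[OF k] v_eig[OF k] by (simp add: w_def algebra_simps)
    also have "\<dots> = (\<Sum>j=1..n. ?H k j * (w k - w j))"
      unfolding sum.distrib[symmetric] by (intro sum.cong) (auto simp: w_def algebra_simps)
    finally show "\<rho> * w k = (\<Sum>j=1..n. ?H k j * (w k - w j))" .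
  qed
  also have "\<dots> = (\<Sum>k=1..i. (\<Sum>j=1..i. ?H k j * (w k - w j)) + (\<Sum>j=Suc i..n. ?H k j * (w k - w j)))"
    by (rule sum.cong[OF refl], rule split)
  also have "\<dots> = (\<Sum>k=1..i. \<Sum>j=1..i. ?H k j * (w k - w j)) + (\<Sum>k=1..i. \<Sum>j=Suc i..n. ?H k j * (w k - w j))"
    by (rule sum.distrib)
  \<comment> \<open>The flow inside the first \<open>i\<close> pairs is antisymmetric.\<close>
  also have "(\<Sum>k=1..i. \<Sum>j=1..i. ?H k j * (w k - w j)) = 0"
  proof -
    have "(\<Sum>k=1..i. \<Sum>j=1..i. ?H k j * (w k - w j)) = (\<Sum>j=1..i. \<Sum>k=1..i. ?H k j * (w k - w j))"
      by (rule sum.swap)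
    also have "\<dots> = (\<Sum>j=1..i. \<Sum>k=1..i. - (?H j k * (w j - w k)))"
      by (intro sum.cong refl) (simp add: H_edge_commute[of n] algebra_simps)
    finally show ?thesis by (simp add: sum_negf)
  qed
  also have "(\<Sum>k=1..i. \<Sum>j=Suc i..n. ?H k j * (w k - w j)) = (\<Sum>k=1..i. \<Sum>j=Suc i..n. if k = i \<and> j = Suc i then w i - w (Suc i) else 0)"
  proof (intro sum.cong refl)
    fix k j assume "k \<in> {1..i}" "j \<in> {Suc i..n}"
    then have "H_edge n k j \<longleftrightarrow> k = i \<and> j = Suc i"
      using H_edge_beyond i n by auto
    then show "?H k j * (w k - w j) = (if k = i \<and> j = Suc i then w i - w (Suc i) else 0)" by simp
  qed
  also have "\<dots> = (\<Sum>k=1..i. if k = i then w i - w (Suc i) else 0)"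
    using i n by (intro sum.cong refl) auto
  also have "\<dots> = w i - w (Suc i)" using i by simp
  finally have eq: "\<rho> * (\<Sum>k=1..i. w k) = w i - w (Suc i)" by simp
  have "(\<Sum>k=1..i. w k) > 0"
    using w_nontrivial partial_sum_pos[of n w i] w_anti sum0 i n by (auto simp: w_def[abs_def])
  then have "\<rho> * (\<Sum>k=1..i. w k) > 0" using rho by simp
  then show ?thesis using eq by simp
qed

lemma u_nbrs: "i \<in> {1..n} \<Longrightarrow> (\<Sum>j=1..n. of_bool (H_edge n i j) * v j) = (3 - \<rho>) * u i"
  using u_eig[of i] cubic_matrix.row[OF cubic_matrix_H[OF n], of i]
  by (simp only: right_diff_distrib sum_subtractf flip: sum_distrib_right) (simp add: algebra_simps)

text \<open>
  If \<open>u i = u (i + 1)\<close>, the neighbours of these two vertices have the same sum of values.  The second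
  neighbourhood arises from the first by moving every index to the right or keeping it, so monotonicity
  forces each value to be unchanged.  One of the moved indices passes from \<open>i\<close> or below to \<open>i + 1\<close> or
  above; hence \<open>v i = v (i + 1)\<close>, which contradicts the strict drop of \<open>w\<close>.
\<close>
lemma u_strict_middle:
  assumes i: "3 \<le> i" "i \<le> n - 3"
  shows "u (Suc i) < u i"
proof (rule ccontr)
  assume neg: "\<not> ?thesis"
  have mem: "i \<in> {1..n}" "Suc i \<in> {1..n}" using i n by auto
  have eq: "u i = u (Suc i)" using neg u_anti[of i "Suc i"] i n by force
  then have nb: "(\<Sum>j=1..n. of_bool (H_edge n i j) * v j) = (\<Sum>j=1..n. of_bool (H_edge n (Suc i) j) * v j)"
    using u_nbrs[OF mem(1)] u_nbrs[OF mem(2)] by (simp del: sum_of_bool_mult_eq)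
  note le = v_anti
  consider "i = 3" "n = 6" | "i = 3" "n \<ge> 7" | "4 \<le> i" "i = n - 3" | "4 \<le> i" "i \<le> n - 4"
    using i n by linarith
  then have "v i = v (Suc i)"
  proof cases
    case 1
    have "v 1 + v 2 + v 4 = v 3 + v 5 + v 6"
      using nb 1 sum_H_edge(2)[OF n, of v] sum_H_edge(4)[OF n, of v] by simp
    then show ?thesis using le[of 1 2] le[of 2 3] le[of 3 4] le[of 4 5] le[of 5 6] 1 by simp
  next
    case 2
    have "v 1 + v 2 + v 4 = v 3 + v 4 + v 5"
      using nb 2 sum_H_edge(2)[OF n, of v] sum_H_edge(3)[OF n, of 4 v] by simp
    then show ?thesis using le[of 1 2] le[of 2 3] le[of 3 4] le[of 4 5] 2 by simp
  next
    case 3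
    have s: "Suc i = n - 2" "i + 1 = n - 2" using 3 by auto
    have "v (i - 1) + v i + v (Suc i) = v (n - 3) + v (n - 1) + v n"
      using nb sum_H_edge(3)[OF n, of i v] sum_H_edge(4)[OF n, of v] 3 unfolding s by simp
    moreover have "v (n - 3) = v i" using 3 by simp
    moreover have "v i \<le> v (i - 1)" by (rule le) (use 3 in auto)
    moreover have "v (Suc i) \<le> v i" by (rule le) (use 3 n in auto)
    moreover have "v (n - 1) \<le> v (Suc i)" by (rule le) (use 3 n in auto)
    moreover have "v n \<le> v (n - 1)" by (rule le) (use n in auto)
    ultimately show ?thesis by linarith
  next
    case 4
    have "v (i - 1) + v i + v (Suc i) = v i + v (Suc i) + v (Suc (Suc i))"
      using nb sum_H_edge(3)[OF n, of i v] sum_H_edge(3)[OF n, of "Suc i" v] 4 by simp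
    moreover have "v i \<le> v (i - 1)" by (rule le) (use 4 n in auto)
    moreover have "v (Suc i) \<le> v i" by (rule le) (use 4 n in auto)
    moreover have "v (Suc (Suc i)) \<le> v (Suc i)" by (rule le) (use 4 n in auto)
    ultimately show ?thesis by linarith
  qed
  then show False using w_strict[OF i] eq by (simp add: w_def)
qed

text \<open>
  At the two ends of the range a tie in one class produces a tie in the middle of the other class.
\<close>
lemma u_strict:
  assumes i: "i \<in> {2..n-2}"
  shows "u (Suc i) < u i"
proof (rule ccontr)
  assume neg: "\<not> ?thesis"
  have mem: "i \<in> {1..n}" "Suc i \<in> {1..n}" using i n by auto
  have "u i = u (Suc i)" using neg u_anti[of i "Suc i"] i n by force
  then have nb: "(\<Sum>j=1..n. of_bool (H_edge n i j) * v j) = (\<Sum>j=1..n. of_bool (H_edge n (Suc i) j) * v j)"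
    using u_nbrs[OF mem(1)] u_nbrs[OF mem(2)] by (simp del: sum_of_bool_mult_eq)
  interpret S: H_eigenpair n v u \<rho> by (rule swapped)
  consider "i = 2" | "i = n - 2" | "3 \<le> i" "i \<le> n - 3" using i by force
  then show False
  proof cases
    case 1
    then have "v 3 = v 4"
      using nb sum_H_edge(1)[OF n, of 2 v] sum_H_edge(2)[OF n, of v] by simp
    moreover have "3 \<le> n - 3" using n by auto
    ultimately show False using S.u_strict_middle[of 3] by simp
  next
    case 2
    have s: "Suc (n - 2) = n - 1" "Suc (n - 3) = n - 2" using n by auto
    have "v (n - 3) = v (n - 2)"
      using nb sum_H_edge(4)[OF n, of v] sum_H_edge(5)[OF n, of "n - 1" v] unfolding 2 s by simp
    moreover have "3 \<le> n - 3" using n by auto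
    ultimately show False using S.u_strict_middle[of "n - 3"] s by simp
  next
    case 3
    then show False using u_strict_middle neg by simp
  qed
qed

end

section \<open>Labelled bipartite graphs\<close>

text \<open>
  A numbering \<open>x\<close>, \<open>y\<close> of the two colour classes, turning the graph into the matrix of the
  relation \<open>edge\<close>.
\<close>
locale bipartite_labelling = pair_graph G for G :: "'a pair_pre_digraph" +
  fixes n :: nat and x y :: "nat \<Rightarrow> 'a"
  assumes inj_x: "inj_on x {1..n}" and inj_y: "inj_on y {1..n}"
    and disjoint: "x ` {1..n} \<inter> y ` {1..n} = {}"
    and verts_eq: "pverts G = x ` {1..n} \<union> y ` {1..n}"
    and arcs_sub: "parcs G \<subseteq> x ` {1..n} \<times> y ` {1..n} \<union> y ` {1..n} \<times> x ` {1..n}"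
begin

abbreviation edge :: "nat \<Rightarrow> nat \<Rightarrow> bool" where "edge i j \<equiv> (x i, y j) \<in> parcs G"

lemma sum_verts:
  fixes F :: "'a \<Rightarrow> real"
  shows "(\<Sum>a\<in>pverts G. F a) = (\<Sum>i=1..n. F (x i) + F (y i))"
proof -
  have "(\<Sum>a\<in>pverts G. F a) = (\<Sum>a\<in>x ` {1..n}. F a) + (\<Sum>a\<in>y ` {1..n}. F a)"
    unfolding verts_eq using disjoint by (intro sum.union_disjoint) auto
  then show ?thesis
    by (simp only: sum.reindex[OF inj_x] sum.reindex[OF inj_y] sum.distrib o_def)
qed

lemma nbrs_x: "i \<in> {1..n} \<Longrightarrow> {b. (x i, b) \<in> parcs G} = y ` ({1..n} \<inter> {j. edge i j})"
  using arcs_sub disjoint by blast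

lemma nbrs_y: "i \<in> {1..n} \<Longrightarrow> {b. (y i, b) \<in> parcs G} = x ` ({1..n} \<inter> {j. edge j i})"
  using arcs_sub disjoint arcs_symmetric by blast

lemma sum_nbrs_x:
  fixes F :: "'a \<Rightarrow> real"
  assumes "i \<in> {1..n}"
  shows "(\<Sum>b | (x i, b) \<in> parcs G. F b) = (\<Sum>j=1..n. of_bool (edge i j) * F (y j))"
proof -
  have "inj_on y ({1..n} \<inter> {j. edge i j})" using inj_y by (rule inj_on_subset) auto
  then show ?thesis unfolding nbrs_x[OF assms] by (simp add: sum.reindex)
qed

lemma sum_nbrs_y:
  fixes F :: "'a \<Rightarrow> real"
  assumes "i \<in> {1..n}"
  shows "(\<Sum>b | (y i, b) \<in> parcs G. F b) = (\<Sum>j=1..n. of_bool (edge j i) * F (x j))"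
proof -
  have "inj_on x ({1..n} \<inter> {j. edge j i})" using inj_x by (rule inj_on_subset) auto
  then show ?thesis unfolding nbrs_y[OF assms] by (simp add: sum.reindex)
qed

lemma lap_x: "i \<in> {1..n} \<Longrightarrow> lap G f (x i) = (\<Sum>j=1..n. of_bool (edge i j) * (f (x i) - f (y j)))"
  unfolding lap_def by (rule sum_nbrs_x)

lemma lap_y: "i \<in> {1..n} \<Longrightarrow> lap G f (y i) = (\<Sum>j=1..n. of_bool (edge j i) * (f (y i) - f (x j)))"
  unfolding lap_def by (rule sum_nbrs_y)

lemma arc_cases:
  assumes "e \<in> parcs G"
  obtains i j where "i \<in> {1..n}" "j \<in> {1..n}" "edge i j" "e = (x i, y j) \<or> e = (y j, x i)"
proof -
  obtain a b where e: "e = (a, b)" by (cases e)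
  from assms arcs_sub e consider "a \<in> x ` {1..n}" "b \<in> y ` {1..n}" | "a \<in> y ` {1..n}" "b \<in> x ` {1..n}"
    by blast
  then show thesis
  proof cases
    case 1
    then obtain i j where "i \<in> {1..n}" "a = x i" "j \<in> {1..n}" "b = y j" by blast
    then show thesis using that[of i j] assms e by simp
  next
    case 2
    then obtain i j where "i \<in> {1..n}" "b = x i" "j \<in> {1..n}" "a = y j" by blast
    then show thesis using that[of i j] assms e arcs_symmetric by simp
  qed
qed

end

locale cubic_labelling = bipartite_labelling +
  assumes cubic: "cubic G"
begin

sublocale cubic_matrix n edge
proof
  show "(\<Sum>j=1..n. of_bool (edge i j)) = (3::real)" if "i \<in> {1..n}" for i
  proof -
    have "card {b. (x i, b) \<in> parcs G} = 3"
      using cubic that verts_eq by (auto simp: cubic_def out_degree_conv)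
    then show ?thesis using sum_nbrs_x[OF that, of "\<lambda>_. 1"] by simp
  qed
  show "(\<Sum>i=1..n. of_bool (edge i j)) = (3::real)" if "j \<in> {1..n}" for j
  proof -
    have "card {b. (y j, b) \<in> parcs G} = 3"
      using cubic that verts_eq by (auto simp: cubic_def out_degree_conv)
    then show ?thesis using sum_nbrs_y[OF that, of "\<lambda>_. 1"] by simp
  qed
qed

lemma dirichlet_cubic:
  "dirichlet G f f = 3 * (\<Sum>a\<in>pverts G. (f a)\<^sup>2)
    - 2 * (\<Sum>i=1..n. \<Sum>j=1..n. of_bool (edge i j) * (f (x i) * f (y j)))"
proof -
  let ?C = "\<Sum>i=1..n. \<Sum>j=1..n. of_bool (edge i j) * (f (x i) * f (y j))"
  have lx: "f (x i) * lap G f (x i) = 3 * (f (x i))\<^sup>2 - (\<Sum>j=1..n. of_bool (edge i j) * (f (x i) * f (y j)))"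
    if "i \<in> {1..n}" for i
  proof -
    have "f (x i) * lap G f (x i) = (\<Sum>j=1..n. of_bool (edge i j) * (f (x i))\<^sup>2 - of_bool (edge i j) * (f (x i) * f (y j)))"
      unfolding lap_x[OF that] sum_distrib_left
      by (rule sum.cong[OF refl]) (simp add: power2_eq_square algebra_simps)
    then show ?thesis unfolding sum_subtractf sum_distrib_right[symmetric] row[OF that] .
  qed
  have ly: "f (y i) * lap G f (y i) = 3 * (f (y i))\<^sup>2 - (\<Sum>j=1..n. of_bool (edge j i) * (f (x j) * f (y i)))"
    if "i \<in> {1..n}" for i
  proof -
    have "f (y i) * lap G f (y i) = (\<Sum>j=1..n. of_bool (edge j i) * (f (y i))\<^sup>2 - of_bool (edge j i) * (f (x j) * f (y i)))"
      unfolding lap_y[OF that] sum_distrib_left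
      by (rule sum.cong[OF refl]) (simp add: power2_eq_square algebra_simps)
    then show ?thesis unfolding sum_subtractf sum_distrib_right[symmetric] col[OF that] .
  qed
  have "dirichlet G f f = (\<Sum>i=1..n. f (x i) * lap G f (x i)) + (\<Sum>i=1..n. f (y i) * lap G f (y i))"
    unfolding dirichlet_def sum_verts by (rule sum.distrib)
  also have "(\<Sum>i=1..n. f (x i) * lap G f (x i)) = 3 * (\<Sum>i=1..n. (f (x i))\<^sup>2) - ?C"
    unfolding sum_distrib_left sum_subtractf[symmetric] by (rule sum.cong[OF refl]) (rule lx)
  also have "(\<Sum>i=1..n. f (y i) * lap G f (y i)) = 3 * (\<Sum>i=1..n. (f (y i))\<^sup>2) - ?C"
    unfolding sum_distrib_left sum_subtractf[symmetric] sum.swap[of "\<lambda>i j. of_bool (edge i j) * _ i j" "{1..n}"]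
    by (rule sum.cong[OF refl]) (rule ly)
  finally show ?thesis by (simp add: sum_verts sum.distrib algebra_simps)
qed

text \<open>
  If all edges at the first \<open>i\<close> vertices of one class end in the first \<open>i\<close> vertices of the other, then by
  counting the converse holds as well, and these \<open>2i\<close> vertices are cut off.
\<close>
lemma connected_corner:
  assumes conn: "Digraph_Component.connected (with_proj G)" and i: "i \<in> {1..<n}"
  shows "corner A i i \<noteq> 3 * real i"
proof
  assume eq: "corner A i i = 3 * real i"
  have E: "\<not> edge k l" if "k \<in> {1..i}" "l \<in> {Suc i..n}" for k l
    using corner_eq_rowsD[OF eq] that i by simp
  have eq': "corner (\<lambda>i j. A j i) i i = 3 * real i" using eq corner_transpose[of A i i] by simp
  have E': "\<not> edge l k" if "k \<in> {1..i}" "l \<in> {Suc i..n}" for k l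
    using cubic_matrix.corner_eq_rowsD[OF cubic_matrix_transpose eq'] that i by simp
  have "x n \<in> x ` {1..i} \<union> y ` {1..i}"
  proof (rule connected_mem_closed_set[OF conn, of "x 1"])
    fix a b assume a: "a \<in> x ` {1..i} \<union> y ` {1..i}" and ab: "(a, b) \<in> parcs G"
    from a show "b \<in> x ` {1..i} \<union> y ` {1..i}"
    proof
      assume "a \<in> x ` {1..i}"
      then obtain k where k: "k \<in> {1..i}" "a = x k" by blast
      then have "b \<in> y ` ({1..n} \<inter> {j. edge k j})" using ab nbrs_x[of k] i by auto
      then obtain l where l: "l \<in> {1..n}" "edge k l" "b = y l" by blast
      then have "l \<in> {1..i}" using E[OF k(1), of l] by force
      then show ?thesis using l by blast
    next
      assume "a \<in> y ` {1..i}"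
      then obtain k where k: "k \<in> {1..i}" "a = y k" by blast
      then have "b \<in> x ` ({1..n} \<inter> {j. edge j k})" using ab nbrs_y[of k] i by auto
      then obtain l where l: "l \<in> {1..n}" "edge l k" "b = x l" by blast
      then have "l \<in> {1..i}" using E'[OF k(1), of l] by force
      then show ?thesis using l by blast
    qed
  qed (use i verts_eq in auto)
  then show False
  proof
    assume "x n \<in> x ` {1..i}"
    then obtain k where "k \<in> {1..i}" "x n = x k" by blast
    then show False using inj_onD[OF inj_x, of n k] i by auto
  next
    assume "x n \<in> y ` {1..i}"
    then have "x n \<in> x ` {1..n} \<inter> y ` {1..n}" using i by auto
    then show False using disjoint by blast
  qed
qed

end

lemma digraph_iso_if_same_edges:
  assumes G: "bipartite_labelling G n x y" and H: "bipartite_labelling H n x' y'"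
    and eq: "\<And>i j. i \<in> {1..n} \<Longrightarrow> j \<in> {1..n} \<Longrightarrow> (x i, y j) \<in> parcs G \<longleftrightarrow> (x' i, y' j) \<in> parcs H"
  shows "digraph_iso (with_proj G) (with_proj H)"
proof -
  interpret G: bipartite_labelling G n x y by (rule G)
  interpret H: bipartite_labelling H n x' y' by (rule H)
  define \<phi> where "\<phi> a = (if a \<in> x ` {1..n} then x' (the_inv_into {1..n} x a) else y' (the_inv_into {1..n} y a))" for a
  have \<phi>x: "\<phi> (x i) = x' i" if "i \<in> {1..n}" for i
    using that by (simp only: \<phi>_def the_inv_into_f_f[OF G.inj_x that] imageI if_True)
  have \<phi>y: "\<phi> (y i) = y' i" if "i \<in> {1..n}" for i
  proof -
    have "y i \<notin> x ` {1..n}" using G.disjoint that by blast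
    then show ?thesis by (simp only: \<phi>_def the_inv_into_f_f[OF G.inj_y that] if_False)
  qed
  have inj: "inj_on \<phi> (pverts G)"
  proof (rule inj_onI)
    fix a b assume a: "a \<in> pverts G" and b: "b \<in> pverts G" and ab: "\<phi> a = \<phi> b"
    from a obtain i where i: "i \<in> {1..n}" "a = x i \<or> a = y i" unfolding G.verts_eq by blast
    from b obtain j where j: "j \<in> {1..n}" "b = x j \<or> b = y j" unfolding G.verts_eq by blast
    have "x' i \<noteq> y' j" "x' j \<noteq> y' i" using H.disjoint i(1) j(1) by blast+
    then show "a = b"
      using i j ab \<phi>x \<phi>y inj_onD[OF H.inj_x, of i j] inj_onD[OF H.inj_y, of i j] by metis
  qed
  have verts: "\<phi> ` pverts G = pverts H"
    unfolding G.verts_eq H.verts_eq image_Un image_image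
    by (intro arg_cong2[of _ _ _ _ "(\<union>)"] image_cong refl \<phi>x \<phi>y)
  have arcs: "map_prod \<phi> \<phi> ` parcs G = parcs H"
  proof (intro equalityI subsetI)
    fix e assume "e \<in> map_prod \<phi> \<phi> ` parcs G"
    then obtain e' where e': "e = map_prod \<phi> \<phi> e'" "e' \<in> parcs G" by (rule imageE)
    obtain i j where ij: "i \<in> {1..n}" "j \<in> {1..n}" "(x i, y j) \<in> parcs G"
      and "e' = (x i, y j) \<or> e' = (y j, x i)"
      by (rule G.arc_cases[OF e'(2)])
    then have e: "e = map_prod \<phi> \<phi> (x i, y j) \<or> e = map_prod \<phi> \<phi> (y j, x i)" using e'(1) by blast
    have "(x' i, y' j) \<in> parcs H" using ij eq by blast
    then show "e \<in> parcs H" using e \<phi>x[OF ij(1)] \<phi>y[OF ij(2)] H.arcs_symmetric by auto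
  next
    fix e assume "e \<in> parcs H"
    then obtain i j where ij: "i \<in> {1..n}" "j \<in> {1..n}" "(x' i, y' j) \<in> parcs H"
      and e: "e = (x' i, y' j) \<or> e = (y' j, x' i)"
      by (rule H.arc_cases)
    have "(x i, y j) \<in> parcs G" using ij eq by blast
    moreover from this have "(y j, x i) \<in> parcs G" by (rule G.arcs_symmetric)
    moreover have "e = map_prod \<phi> \<phi> (x i, y j) \<or> e = map_prod \<phi> \<phi> (y j, x i)"
      using e \<phi>x[OF ij(1)] \<phi>y[OF ij(2)] by auto
    ultimately show "e \<in> map_prod \<phi> \<phi> ` parcs G" by (elim disjE) (simp_all only: imageI)
  qed
  define h where "h = \<lparr>iso_verts = \<phi>, iso_arcs = map_prod \<phi> \<phi>, iso_head = snd, iso_tail = fst\<rparr>"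
  have "parcs G \<subseteq> pverts G \<times> pverts G" using G.in_arcsD1 G.in_arcsD2 by auto
  then have "inj_on (map_prod \<phi> \<phi>) (parcs G)" using map_prod_inj_on[OF inj inj] by (rule inj_on_subset[rotated])
  then have "pre_digraph.digraph_isomorphism (with_proj G) h"
    using inj G.wf_digraph_axioms by (simp add: pre_digraph.digraph_isomorphism_def h_def)
  moreover have "with_proj H = app_iso h (with_proj G)"
    by (simp add: app_iso_def h_def verts arcs with_proj_def)
  ultimately show ?thesis unfolding digraph_iso_def by blast
qed

lemma sorted_enumeration:
  fixes f :: "'a \<Rightarrow> real"
  assumes "finite X"
  obtains x where "bij_betw x {1..card X} X" "\<And>i j. 1 \<le> i \<Longrightarrow> i \<le> j \<Longrightarrow> j \<le> card X \<Longrightarrow> f (x j) \<le> f (x i)"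
proof -
  obtain xs where xs: "distinct xs" "set xs = X" using finite_distinct_list[OF assms] by blast
  define ys where "ys = sort_key (\<lambda>a. - f a) xs"
  have ys: "distinct ys" "set ys = X" "length ys = card X"
    using xs distinct_card[OF xs(1)] by (simp_all add: ys_def)
  have "bij_betw ((!) ys \<circ> (\<lambda>i. i - 1)) {1..card X} X"
  proof (rule bij_betw_trans)
    show "bij_betw (\<lambda>i. i - 1) {1..card X} {..<card X}"
      by (rule bij_betw_byWitness[of _ Suc]) auto
    show "bij_betw ((!) ys) {..<card X} X" using ys by (intro bij_betw_nth) auto
  qed
  moreover have "f (((!) ys \<circ> (\<lambda>i. i - 1)) j) \<le> f (((!) ys \<circ> (\<lambda>i. i - 1)) i)"
    if "1 \<le> i" "i \<le> j" "j \<le> card X" for i j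
  proof -
    have "sorted (map (\<lambda>a. - f a) ys)" by (simp add: ys_def)
    then have "map (\<lambda>a. - f a) ys ! (i - 1) \<le> map (\<lambda>a. - f a) ys ! (j - 1)"
      by (rule sorted_nth_mono) (use that ys in auto)
    then show ?thesis using that ys by simp
  qed
  ultimately show thesis by (rule that)
qed

text \<open>
  Both colour classes have \<open>n\<close> vertices, because each of them is incident with every edge and all
  degrees are \<open>3\<close>.
\<close>
lemma sorted_labelling:
  fixes f :: "'a \<Rightarrow> real"
  assumes G: "connected_cubic_bipartite (2 * n) G"
  obtains x y where "cubic_labelling G n x y"
    "\<And>i j. 1 \<le> i \<Longrightarrow> i \<le> j \<Longrightarrow> j \<le> n \<Longrightarrow> f (x j) \<le> f (x i)"
    "\<And>i j. 1 \<le> i \<Longrightarrow> i \<le> j \<Longrightarrow> j \<le> n \<Longrightarrow> f (y j) \<le> f (y i)"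
proof -
  interpret pair_graph G using G by (simp add: connected_cubic_bipartite_def)
  obtain X Y where XY: "X \<union> Y = pverts G" "X \<inter> Y = {}" "parcs G \<subseteq> X \<times> Y \<union> Y \<times> X"
    and cub: "cubic G" and card: "card (pverts G) = 2 * n"
    using G by (auto simp: connected_cubic_bipartite_def bipartite_def)
  have fin: "finite X" "finite Y" using XY(1) pair_finite_verts by (metis finite_Un)+
  have deg: "card (parcs G \<inter> X' \<times> Y') = 3 * card X'"
    if "X' \<subseteq> pverts G" "finite X'" "\<And>a b. a \<in> X' \<Longrightarrow> (a, b) \<in> parcs G \<Longrightarrow> b \<in> Y'" for X' Y'
  proof -
    have "parcs G \<inter> X' \<times> Y' = (SIGMA a:X'. {b. (a, b) \<in> parcs G})" using that(3) by blast
    then have "card (parcs G \<inter> X' \<times> Y') = (\<Sum>a\<in>X'. card {b. (a, b) \<in> parcs G})"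
      using that(2) by simp
    also have "\<dots> = (\<Sum>a\<in>X'. 3)"
      using cub that(1) by (intro sum.cong refl) (auto simp: cubic_def out_degree_conv)
    finally show ?thesis by simp
  qed
  have "card (parcs G \<inter> X \<times> Y) = 3 * card X" by (rule deg) (use XY fin in auto)
  moreover have "card (parcs G \<inter> Y \<times> X) = 3 * card Y" by (rule deg) (use XY fin in auto)
  moreover have "card (parcs G \<inter> X \<times> Y) = card (parcs G \<inter> Y \<times> X)"
    by (rule bij_betw_same_card[of prod.swap], rule bij_betw_byWitness[of _ prod.swap])
      (auto intro: arcs_symmetric)
  ultimately have "card X = card Y" by simp
  moreover have "card X + card Y = 2 * n"
    using card_Un_disjoint[OF fin XY(2)] XY(1) card by simp
  ultimately have cards: "card X = n" "card Y = n" by auto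
  obtain x where x: "bij_betw x {1..n} X" "\<And>i j. 1 \<le> i \<Longrightarrow> i \<le> j \<Longrightarrow> j \<le> n \<Longrightarrow> f (x j) \<le> f (x i)"
    using sorted_enumeration[OF fin(1), of f] unfolding cards by blast
  obtain y where y: "bij_betw y {1..n} Y" "\<And>i j. 1 \<le> i \<Longrightarrow> i \<le> j \<Longrightarrow> j \<le> n \<Longrightarrow> f (y j) \<le> f (y i)"
    using sorted_enumeration[OF fin(2), of f] unfolding cards by blast
  have "cubic_labelling G n x y"
    by unfold_locales (use x(1) y(1) XY cub in \<open>auto simp: bij_betw_def\<close>)
  then show thesis using x(2) y(2) by (rule that)
qed

section \<open>\<open>H\<^sub>2\<^sub>n\<close> is a connected cubic bipartite graph\<close>

lemma H_edge_range: "n \<ge> 6 \<Longrightarrow> H_edge n i j \<Longrightarrow> i \<in> {1..n} \<and> j \<in> {1..n}"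
  unfolding H_edge_def by auto

lemma H_graph_arcs [simp]:
  "(Inl i, Inr j) \<in> parcs (H_graph n) \<longleftrightarrow> H_edge n i j"
  "(Inr j, Inl i) \<in> parcs (H_graph n) \<longleftrightarrow> H_edge n i j"
  by (auto simp: H_graph_def)

lemma pair_graph_H:
  assumes n: "n \<ge> 6"
  shows "pair_graph (H_graph n)"
proof -
  have sub: "parcs (H_graph n) \<subseteq> pverts (H_graph n) \<times> pverts (H_graph n)"
    using H_edge_range[OF n] by (auto simp: H_graph_def)
  have fin: "finite (pverts (H_graph n))" by (simp add: H_graph_def)
  have "finite (parcs (H_graph n))" using sub by (rule finite_subset) (use fin in auto)
  moreover have "sym (parcs (H_graph n))" by (auto simp: H_graph_def sym_def)
  moreover have "fst e \<in> pverts (H_graph n)" "snd e \<in> pverts (H_graph n)" if "e \<in> parcs (H_graph n)" for e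
    using sub that by auto
  moreover have "fst e \<noteq> snd e" if "e \<in> parcs (H_graph n)" for e
    using that by (auto simp: H_graph_def)
  ultimately show ?thesis
    using fin by unfold_locales (simp_all add: symmetric_def)
qed

lemma bipartite_labelling_H:
  assumes n: "n \<ge> 6"
  shows "bipartite_labelling (H_graph n) n Inl Inr"
proof -
  interpret pair_graph "H_graph n" by (rule pair_graph_H[OF n])
  show ?thesis
  proof
    show "parcs (H_graph n) \<subseteq> Inl ` {1..n} \<times> Inr ` {1..n} \<union> Inr ` {1..n} \<times> Inl ` {1..n}"
      using H_edge_range[OF n] unfolding H_graph_def pair_pre_digraph.simps by blast
  qed (auto simp: H_graph_def)
qed

lemma cubic_H:
  assumes n: "n \<ge> 6"
  shows "cubic (H_graph n)"
proof -
  interpret bipartite_labelling "H_graph n" n Inl Inr by (rule bipartite_labelling_H[OF n])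
  interpret M: cubic_matrix n "H_edge n" by (rule cubic_matrix_H[OF n])
  have "real (card {b. (Inl i, b) \<in> parcs (H_graph n)}) = 3" if "i \<in> {1..n}" for i
    using sum_nbrs_x[OF that, of "\<lambda>_. 1"] M.row[OF that] by simp
  moreover have "real (card {b. (Inr i, b) \<in> parcs (H_graph n)}) = 3" if "i \<in> {1..n}" for i
    using sum_nbrs_y[OF that, of "\<lambda>_. 1"] M.col[OF that] by simp
  ultimately show ?thesis
    unfolding cubic_def out_degree_conv verts_eq by auto
qed

lemma connected_H:
  assumes n: "n \<ge> 6"
  shows "Digraph_Component.connected (with_proj (H_graph n))"
proof -
  interpret bipartite_labelling "H_graph n" n Inl Inr by (rule bipartite_labelling_H[OF n])
  let ?G = "with_proj (H_graph n)"
  have step: "Inl 1 \<rightarrow>\<^sup>*\<^bsub>?G\<^esub> b" if "Inl 1 \<rightarrow>\<^sup>*\<^bsub>?G\<^esub> a" "(a, b) \<in> parcs (H_graph n)" for a b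
    using that reachable_adj_trans by blast
  have start: "Inl 1 \<rightarrow>\<^sup>*\<^bsub>?G\<^esub> Inl (1::nat)" using verts_eq n by (intro reachable_refl) auto
  have r: "Inl 1 \<rightarrow>\<^sup>*\<^bsub>?G\<^esub> Inr j" if "j \<in> {1,2,3}" for j
    by (rule step[OF start]) (use that in \<open>auto simp: H_edge_def\<close>)
  have l: "Inl 1 \<rightarrow>\<^sup>*\<^bsub>?G\<^esub> Inl j" if "j \<in> {1,2,3}" for j
    by (rule step[OF r[of 1]]) (use that in \<open>auto simp: H_edge_def\<close>)
  have mid: "Inl 1 \<rightarrow>\<^sup>*\<^bsub>?G\<^esub> Inl (i + 3) \<and> Inl 1 \<rightarrow>\<^sup>*\<^bsub>?G\<^esub> Inr (i + 3)" if "i + 3 \<le> n - 2" for i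
    using that
  proof (induction i)
    case 0
    then show ?case using l[of 3] r[of 3] by simp
  next
    case (Suc i)
    then have IH: "Inl 1 \<rightarrow>\<^sup>*\<^bsub>?G\<^esub> Inl (i + 3)" "Inl 1 \<rightarrow>\<^sup>*\<^bsub>?G\<^esub> Inr (i + 3)" by auto
    have "H_edge n (i + 3) (Suc i + 3)" using Suc.prems n by (auto simp: H_edge_def)
    moreover from this have "H_edge n (Suc i + 3) (i + 3)" using H_edge_commute by blast
    ultimately show ?case using step[OF IH(1)] step[OF IH(2)] by simp
  qed
  have "n - 5 + 3 = n - 2" using n by simp
  then have pre: "Inl 1 \<rightarrow>\<^sup>*\<^bsub>?G\<^esub> Inl (n - 2)" "Inl 1 \<rightarrow>\<^sup>*\<^bsub>?G\<^esub> Inr (n - 2)"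
    using mid[of "n - 5"] \<open>n - 5 + 3 = n - 2\<close> by simp_all
  have last: "Inl 1 \<rightarrow>\<^sup>*\<^bsub>?G\<^esub> Inl j \<and> Inl 1 \<rightarrow>\<^sup>*\<^bsub>?G\<^esub> Inr j" if "j \<in> {n - 1, n}" for j
  proof -
    have "H_edge n (n - 2) j" using that H_nbrs(4)[OF n] by blast
    moreover from this have "H_edge n j (n - 2)" using H_edge_commute by blast
    ultimately show ?thesis using step[OF pre(1)] step[OF pre(2)] by simp
  qed
  have all: "Inl 1 \<rightarrow>\<^sup>*\<^bsub>?G\<^esub> Inl j \<and> Inl 1 \<rightarrow>\<^sup>*\<^bsub>?G\<^esub> Inr j" if j: "j \<in> {1..n}" for j
  proof -
    consider "j \<le> 3" | "3 \<le> j" "j \<le> n - 2" | "n - 2 < j" by linarith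
    then show ?thesis
    proof cases
      case 1
      then have j3: "j \<in> {1,2,3}" using j by auto
      show ?thesis using l[OF j3] r[OF j3] ..
    next
      case 2
      then show ?thesis using mid[of "j - 3"] by simp
    next
      case 3
      then have "j \<in> {n - 1, n}" using j by auto
      then show ?thesis by (rule last)
    qed
  qed
  have reach: "Inl 1 \<rightarrow>\<^sup>*\<^bsub>?G\<^esub> a" if "a \<in> pverts (H_graph n)" for a
  proof -
    obtain j where j: "j \<in> {1..n}" "a = Inl j \<or> a = Inr j"
      using \<open>a \<in> pverts (H_graph n)\<close> unfolding verts_eq by auto
    from j(2) show ?thesis by (elim disjE) (simp_all only: all[OF j(1)])
  qed
  have "strongly_connected ?G"
    unfolding strongly_connected_def with_proj_simps
  proof (intro conjI ballI)
    show "pverts (H_graph n) \<noteq> {}" using n by (simp add: H_graph_def)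
    fix a b assume "a \<in> pverts (H_graph n)" "b \<in> pverts (H_graph n)"
    then show "a \<rightarrow>\<^sup>*\<^bsub>?G\<^esub> b" by (intro reachable_trans[OF symmetric_reachable'[OF reach] reach])
  qed
  moreover have "mk_symmetric ?G = H_graph n"
    using arcs_symmetric by (auto simp: mk_symmetric_def intro!: pair_pre_digraph.equality)
  ultimately show ?thesis unfolding Digraph_Component.connected_def by simp
qed

lemma connected_cubic_bipartite_H:
  assumes n: "n \<ge> 6"
  shows "connected_cubic_bipartite (2 * n) (H_graph n)"
proof -
  interpret bipartite_labelling "H_graph n" n Inl Inr by (rule bipartite_labelling_H[OF n])
  have "bipartite (H_graph n)"
    unfolding bipartite_def
    by (intro exI conjI) (rule verts_eq[symmetric], rule disjoint, rule arcs_sub)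
  moreover have "card (pverts (H_graph n)) = 2 * n"
    using sum_verts[of "\<lambda>_. 1"] by simp
  ultimately show ?thesis
    unfolding connected_cubic_bipartite_def
    using pair_graph_H connected_H cubic_H n by blast
qed

section \<open>The minimum of the algebraic connectivity\<close>

theorem theorem1p4:
  fixes n :: nat
  assumes "n \<ge> 6"
  shows "connected_cubic_bipartite (2 * n) (H_graph n) \<and>
    (\<forall>G :: 'a pair_pre_digraph. connected_cubic_bipartite (2 * n) G \<longrightarrow>
       algebraic_connectivity (H_graph n) \<le> algebraic_connectivity G \<and>
       (algebraic_connectivity G = algebraic_connectivity (H_graph n) \<longrightarrow>
          digraph_iso (with_proj G) (with_proj (H_graph n))))"
proof (intro conjI allI impI)
  note n = assms
  show H: "connected_cubic_bipartite (2 * n) (H_graph n)" by (rule connected_cubic_bipartite_H[OF n])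
  fix G :: "'a pair_pre_digraph"
  assume G: "connected_cubic_bipartite (2 * n) G"
  interpret G: pair_graph G using G by (simp add: connected_cubic_bipartite_def)
  have conn: "Digraph_Component.connected (with_proj G)" and "card (pverts G) = 2 * n"
    using G by (simp_all add: connected_cubic_bipartite_def)
  then have "card (pverts G) \<ge> 2" using n by simp
  then obtain f where f: "\<exists>a\<in>pverts G. f a \<noteq> 0" "(\<Sum>a\<in>pverts G. f a) = 0"
    "dirichlet G f f \<le> algebraic_connectivity G * (\<Sum>a\<in>pverts G. (f a)\<^sup>2)"
    by (rule G.test_function_below_algebraic_connectivity)
  obtain x y where lab: "cubic_labelling G n x y"
    and x_anti: "\<And>i j. 1 \<le> i \<Longrightarrow> i \<le> j \<Longrightarrow> j \<le> n \<Longrightarrow> f (x j) \<le> f (x i)"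
    and y_anti: "\<And>i j. 1 \<le> i \<Longrightarrow> i \<le> j \<Longrightarrow> j \<le> n \<Longrightarrow> f (y j) \<le> f (y i)"
    using sorted_labelling[OF G, of f] by blast
  interpret G: cubic_labelling G n x y by (rule lab)
  interpret H: bipartite_labelling "H_graph n" n Inl Inr by (rule bipartite_labelling_H[OF n])
  interpret H: cubic_labelling "H_graph n" n Inl Inr by unfold_locales (rule cubic_H[OF n])
  have "card (pverts (H_graph n)) \<ge> 2" using H n by (simp add: connected_cubic_bipartite_def)
  then obtain \<rho> where \<rho>: "0 < \<rho>" "algebraic_connectivity (H_graph n) \<le> \<rho>"
    and gap: "\<And>g. (\<Sum>a\<in>pverts (H_graph n). g a) = 0 \<Longrightarrow>
      \<rho> * (\<Sum>a\<in>pverts (H_graph n). (g a)\<^sup>2) \<le> dirichlet (H_graph n) g g"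
    using H.connected_spectral_gap[OF connected_H[OF n]] by blast
  define u v where "u i = f (x i)" and "v i = f (y i)" for i
  define h where "h = case_sum u v"
  have [simp]: "h (Inl i) = u i" "h (Inr i) = v i" for i by (simp_all add: h_def)
  define N where "N = (\<Sum>a\<in>pverts G. (f a)\<^sup>2)"
  have N: "(\<Sum>a\<in>pverts (H_graph n). (h a)\<^sup>2) = N"
    by (simp add: N_def G.sum_verts H.sum_verts u_def v_def)
  have "N \<noteq> 0" using f(1) G.pair_finite_verts unfolding N_def by (subst sum_nonneg_eq_0_iff) auto
  then have "N > 0" by (simp add: N_def sum_nonneg less_le)
  have h0: "(\<Sum>a\<in>pverts (H_graph n). h a) = 0"
    using f(2) by (simp add: G.sum_verts H.sum_verts u_def v_def)
  interpret C: corner_dominated n G.A "\<lambda>i j. of_bool (H_edge n i j)" u v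
  proof
    fix i assume "i \<in> {1..n}"
    then show "(\<Sum>j=1..n. G.A i j) = (\<Sum>j=1..n. of_bool (H_edge n i j))"
      using G.row[of i] H.row[of i] by (simp only: H_graph_arcs)
    show "(\<Sum>j=1..n. G.A j i) = (\<Sum>j=1..n. of_bool (H_edge n j i))"
      using \<open>i \<in> {1..n}\<close> G.col[of i] H.col[of i] by (simp only: H_graph_arcs)
  next
    fix i j assume "i \<in> {1..<n}" "j \<in> {1..<n}"
    then show "corner G.A i j \<le> corner (\<lambda>i j. of_bool (H_edge n i j)) i j"
      using G.corner_le_corner_H[OF n] G.connected_corner[OF conn] by blast
  qed (use x_anti y_anti in \<open>auto simp: u_def v_def\<close>)
  let ?B = "\<lambda>E. \<Sum>i=1..n. \<Sum>j=1..n. of_bool (E i j) * (u i * v j) :: real"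
  have DG: "dirichlet G f f = 3 * N - 2 * ?B G.edge"
    by (simp only: G.dirichlet_cubic N_def u_def v_def)
  have DH: "dirichlet (H_graph n) h h = 3 * N - 2 * ?B (H_edge n)"
    unfolding H.dirichlet_cubic N by (simp only: H_graph_arcs \<open>\<And>i. h (Inl i) = u i\<close> \<open>\<And>i. h (Inr i) = v i\<close>)
  \<comment> \<open>The sorted values of \<open>f\<close>, moved to \<open>H\<^sub>2\<^sub>n\<close>, do not have a larger Dirichlet form.\<close>
  have DH_le_DG: "dirichlet (H_graph n) h h \<le> dirichlet G f f"
    using C.bilinear_le unfolding DG DH by linarith
  have "\<rho> * N \<le> dirichlet (H_graph n) h h" using gap[OF h0] unfolding N .
  then have chain: "\<rho> * N \<le> dirichlet (H_graph n) h h" "dirichlet G f f \<le> algebraic_connectivity G * N"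
    using f(3) by (simp_all add: N_def)
  then have "\<rho> * N \<le> algebraic_connectivity G * N" using DH_le_DG by linarith
  then have \<rho>_le: "\<rho> \<le> algebraic_connectivity G" using \<open>N > 0\<close> by simp
  then show "algebraic_connectivity (H_graph n) \<le> algebraic_connectivity G" using \<rho>(2) by linarith
  assume eq: "algebraic_connectivity G = algebraic_connectivity (H_graph n)"
  then have \<rho>_eq: "algebraic_connectivity G = \<rho>" using \<rho>_le \<rho>(2) by linarith
  \<comment> \<open>All inequalities of the chain are now equalities.\<close>
  then have B_eq: "?B G.edge = ?B (H_edge n)" and "dirichlet (H_graph n) h h \<le> \<rho> * N"
    using chain DH_le_DG unfolding DG DH by simp_all
  then have eig: "lap (H_graph n) h a = \<rho> * h a" if "a \<in> pverts (H_graph n)" for a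
    using H.minimiser_imp_eigenfunction[OF gap h0] that unfolding N by blast
  \<comment> \<open>The function with values \<open>1\<close> and \<open>-1\<close> at two twin vertices and \<open>0\<close> elsewhere has Rayleigh
     quotient \<open>3\<close>.\<close>
  have "\<rho> < 6"
  proof -
    define g :: "nat + nat \<Rightarrow> real" where "g a = (if a = Inl 1 then 1 else if a = Inl 2 then - 1 else 0)" for a
    have g: "g (Inl i) = of_bool (i = 1) - of_bool (i = 2)" "g (Inr i) = 0" for i
      by (simp_all add: g_def)
    have "(\<Sum>i=1..n. g (Inl i)) = 0"
      using n by (simp add: g sum_subtractf)
    moreover have "(\<Sum>i=1..n. (g (Inl i))\<^sup>2) = (\<Sum>i=1..n. of_bool (i = 1) + of_bool (i = 2))"
      by (intro sum.cong refl) (simp add: g)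
    then have "(\<Sum>i=1..n. (g (Inl i))\<^sup>2) = 2"
      using n by (simp add: sum.distrib)
    ultimately show ?thesis
      using gap[of g] unfolding H.dirichlet_cubic H.sum_verts by (simp add: g(2))
  qed
  interpret P: H_eigenpair n u v \<rho>
  proof
    fix i assume i: "i \<in> {1..n}"
    show "(\<Sum>j=1..n. of_bool (H_edge n i j) * (u i - v j)) = \<rho> * u i"
      using eig[of "Inl i"] H.lap_x[OF i, of h] i H.verts_eq by simp
    show "(\<Sum>j=1..n. of_bool (H_edge n i j) * (v i - u j)) = \<rho> * v i"
      using eig[of "Inr i"] H.lap_y[OF i, of h] i H.verts_eq by (simp add: H_edge_commute[of n _ i])
  next
    show "(\<Sum>k=1..n. u k + v k) = 0" using h0 by (simp add: H.sum_verts)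
    show "\<exists>i\<in>{1..n}. u i \<noteq> 0 \<or> v i \<noteq> 0"
      using f(1) unfolding G.verts_eq u_def v_def by blast
  qed (use n x_anti y_anti \<rho>(1) \<open>\<rho> < 6\<close> in \<open>auto simp: u_def v_def\<close>)
  interpret P': H_eigenpair n v u \<rho> by (rule P.swapped)
  have "corner G.A i j = corner (\<lambda>i j. of_bool (H_edge n i j)) i j"
    if "i \<in> {2..n-2}" "j \<in> {2..n-2}" for i j
    using C.bilinear_eqD[OF B_eq, of i j] P.u_strict[OF that(1)] P'.u_strict[OF that(2)] that n by auto
  then have "G.edge i j \<longleftrightarrow> H_edge n i j" if "i \<in> {1..n}" "j \<in> {1..n}" for i j
    using G.eq_H_if_corners_eq[OF n] that by blast
  then show "digraph_iso (with_proj G) (with_proj (H_graph n))"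
    using G.bipartite_labelling_axioms H.bipartite_labelling_axioms
    by (intro digraph_iso_if_same_edges) auto
qed

end
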